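(* If $G$ is a Laman graph on the vertex set $[n]$, then the complex algebraic variety $X_G\subset\mathbb{C}^{4n}$ has dimension exactly $2n+3$.
   Context: A graph $G=(V,E)$ is a Laman graph if $|E|=2|V|-3$ and every subgraph $G'=(V',E')$ of $G$ with $|V'|\ge 2$ satisfies $|E'|\le 2|V'|-3$. All lines in $\mathbb{C}^3$ are assumed non-horizontal. A line $\ell(t)=(a,b,0)+t(c,d,1)$, $t\in\mathbb{C}$, is identified with the point $(a,b,c,d)\in\mathbb{C}^4$; thus a point $x\in\mathbb{C}^{4n}=(\mathbb{C}^4)^n$ is identified with a sequence $L(x)=(\ell_1,\dots,\ell_n)$ of $n$ (not necessarily distinct) lines. The intersection graph $G_L=([n],E)$ of a sequence $L=(\ell_1,\dots,\ell_n)$ has $\{i,j\}\in E$ iff $i\ne j$ and $\ell_i,\ell_j$ intersect, are parallel, or coincide (equivalently $(a_i-a_j)(d_i-d_j)-(b_i-b_j)(c_i-c_j)=0$). For graphs on the same vertex set, $G_1\subset G_2$ means the edge set of $G_1$ is contained in that of $G_2$. For a graph $G$ on $[n]$, let $\hat X_G=\{x\in\mathbb{C}^{4n}: G\subset G_{L(x)}\text{ and the lines of }L(x)\text{ are pairwise distinct}\}$ and let $X_G$ be the Zariski closure of $\hat X_G$. *)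

theory Defs
  imports Complex_Main "HOL-Library.FuncSet" "HOL-Library.Extended_Nat" "HOL-Library.Ramsey"
    "HOL-Library.Product_Plus"
begin

section \<open>Affine algebraic sets over the complex numbers\<close>

text \<open>Affine space with coordinates indexed by a finite set \<open>I\<close>. Its points are extensional
  functions, so that equality of points is equality of their \<open>I\<close>-coordinates.\<close>

definition affine_space :: "'i set \<Rightarrow> ('i \<Rightarrow> complex) set" where
  "affine_space I = I \<rightarrow>\<^sub>E UNIV"

inductive_set poly_funs :: "'i set \<Rightarrow> (('i \<Rightarrow> complex) \<Rightarrow> complex) set" for I where
  const: "(\<lambda>_. c) \<in> poly_funs I"
| coord: "i \<in> I \<Longrightarrow> (\<lambda>x. x i) \<in> poly_funs I"
| add: "p \<in> poly_funs I \<Longrightarrow> q \<in> poly_funs I \<Longrightarrow> (\<lambda>x. p x + q x) \<in> poly_funs I"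
| mult: "p \<in> poly_funs I \<Longrightarrow> q \<in> poly_funs I \<Longrightarrow> (\<lambda>x. p x * q x) \<in> poly_funs I"

definition zariski_closed :: "'i set \<Rightarrow> ('i \<Rightarrow> complex) set \<Rightarrow> bool" where
  "zariski_closed I Z \<longleftrightarrow>
    (\<exists>P \<subseteq> poly_funs I. Z = {x \<in> affine_space I. \<forall>p\<in>P. p x = 0})"

definition zariski_closure :: "'i set \<Rightarrow> ('i \<Rightarrow> complex) set \<Rightarrow> ('i \<Rightarrow> complex) set" where
  "zariski_closure I S = \<Inter> {Z. zariski_closed I Z \<and> S \<subseteq> Z}"

definition irreducible_closed :: "'i set \<Rightarrow> ('i \<Rightarrow> complex) set \<Rightarrow> bool" where
  "irreducible_closed I Z \<longleftrightarrow> zariski_closed I Z \<and> Z \<noteq> {} \<and>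
    (\<forall>A B. zariski_closed I A \<and> zariski_closed I B \<and> Z = A \<union> B \<longrightarrow> Z = A \<or> Z = B)"

text \<open>Krull dimension of a closed set \<open>X\<close>, which may be reducible: the supremum of the lengths \<open>k\<close>
  of chains \<open>Z 0 \<subset> \<dots> \<subset> Z k\<close> of irreducible closed subsets of \<open>X\<close>. The empty set is given
  dimension \<open>0\<close> here, rather than the usual \<open>-\<infinity>\<close>.\<close>

definition variety_dim :: "'i set \<Rightarrow> ('i \<Rightarrow> complex) set \<Rightarrow> enat" where
  "variety_dim I X = Sup {enat k | k. \<exists>Z :: nat \<Rightarrow> ('i \<Rightarrow> complex) set.
      (\<forall>i\<le>k. irreducible_closed I (Z i) \<and> Z i \<subseteq> X) \<and> (\<forall>i<k. Z i \<subset> Z (Suc i))}"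


section \<open>Laman graphs\<close>

definition simple_graph :: "'v set \<Rightarrow> 'v set set \<Rightarrow> bool" where
  "simple_graph V E \<longleftrightarrow> finite V \<and> E \<subseteq> nsets V 2"

text \<open>The edge counts are compared in \<open>int\<close>, since truncated subtraction would make a single
  vertex a Laman graph.\<close>

definition laman_graph :: "'v set \<Rightarrow> 'v set set \<Rightarrow> bool" where
  "laman_graph V E \<longleftrightarrow> simple_graph V E \<and> int (card E) = 2 * int (card V) - 3 \<and>
    (\<forall>V' E'. simple_graph V' E' \<and> V' \<subseteq> V \<and> E' \<subseteq> E \<and> card V' \<ge> 2
       \<longrightarrow> int (card E') \<le> 2 * int (card V') - 3)"


section \<open>Configurations of non-horizontal lines\<close>

type_synonym point3 = "complex \<times> complex \<times> complex"

definition line :: "complex \<Rightarrow> complex \<Rightarrow> complex \<Rightarrow> complex \<Rightarrow> point3 set" where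
  "line a b c d = range (\<lambda>t. (a + t * c, b + t * d, t))"

definition parallel :: "point3 set \<Rightarrow> point3 set \<Rightarrow> bool" where
  "parallel l m \<longleftrightarrow> (\<exists>v. m = (+) v ` l)"

definition incident :: "point3 set \<Rightarrow> point3 set \<Rightarrow> bool" where
  "incident l m \<longleftrightarrow> l \<inter> m \<noteq> {} \<or> parallel l m \<or> l = m"

text \<open>The index set of the coordinates of \<open>\<complex>\<^sup>4\<^sup>n = (\<complex>\<^sup>4)\<^sup>n\<close>: the point \<open>x\<close> has
  \<open>(a\<^sub>i, b\<^sub>i, c\<^sub>i, d\<^sub>i) = (x (i, 1), x (i, 2), x (i, 3), x (i, 4))\<close>.\<close>

definition coords :: "nat \<Rightarrow> (nat \<times> nat) set" where
  "coords n = {1..n} \<times> {1..4}"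

definition lines_of :: "(nat \<times> nat \<Rightarrow> complex) \<Rightarrow> nat \<Rightarrow> point3 set" where
  "lines_of x i = line (x (i, 1)) (x (i, 2)) (x (i, 3)) (x (i, 4))"

definition intersection_edges :: "nat \<Rightarrow> (nat \<Rightarrow> point3 set) \<Rightarrow> nat set set" where
  "intersection_edges n L =
    {{i, j} | i j. i \<in> {1..n} \<and> j \<in> {1..n} \<and> i \<noteq> j \<and> incident (L i) (L j)}"

definition X_hat :: "nat \<Rightarrow> nat set set \<Rightarrow> (nat \<times> nat \<Rightarrow> complex) set" where
  "X_hat n E = {x \<in> affine_space (coords n).
    E \<subseteq> intersection_edges n (lines_of x) \<and> inj_on (lines_of x) {1..n}}"

definition X_var :: "nat \<Rightarrow> nat set set \<Rightarrow> (nat \<times> nat \<Rightarrow> complex) set" where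
  "X_var n E = zariski_closure (coords n) (X_hat n E)"


section \<open>Lines in coordinates\<close>

lemma mem_line: "(u, v, t) \<in> line a b c d \<longleftrightarrow> u = a + t * c \<and> v = b + t * d"
  by (auto simp: line_def)

lemma line_eq_iff:
  "line a b c d = line a' b' c' d' \<longleftrightarrow> a = a' \<and> b = b' \<and> c = c' \<and> d = d'"
proof
  assume eq: "line a b c d = line a' b' c' d'"
  have "(a, b, 0) \<in> line a' b' c' d'" "(a + c, b + d, 1) \<in> line a' b' c' d'"
    unfolding eq[symmetric] by (simp_all add: mem_line)
  then show "a = a' \<and> b = b' \<and> c = c' \<and> d = d'" by (simp add: mem_line)
qed simp

lemma parallel_line_iff:
  "parallel (line a b c d) (line a' b' c' d') \<longleftrightarrow> c = c' \<and> d = d'"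
proof
  assume "parallel (line a b c d) (line a' b' c' d')"
  then obtain v1 v2 v3 where eq: "line a' b' c' d' = (+) (v1, v2, v3) ` line a b c d"
    unfolding parallel_def by auto
  have "(v1, v2, v3) + (a, b, 0) \<in> line a' b' c' d'"
       "(v1, v2, v3) + (a + c, b + d, 1) \<in> line a' b' c' d'"
    unfolding eq by (rule imageI, simp add: mem_line)+
  then have "a + v1 = a' + v3 * c'" "b + v2 = b' + v3 * d'"
       "a + c + v1 = a' + (v3 + 1) * c'" "b + d + v2 = b' + (v3 + 1) * d'"
    by (simp_all add: mem_line algebra_simps)
  then show "c = c' \<and> d = d'" by algebra
next
  assume cd: "c = c' \<and> d = d'"
  have "line a' b' c' d' = (+) (a' - a, b' - b, 0) ` line a b c d"
    using cd by (simp add: line_def image_image algebra_simps)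
  then show "parallel (line a b c d) (line a' b' c' d')"
    unfolding parallel_def by blast
qed

lemma incident_line_iff:
  "incident (line a b c d) (line a' b' c' d') \<longleftrightarrow>
    (a - a') * (d - d') - (b - b') * (c - c') = 0"
proof
  assume inc: "incident (line a b c d) (line a' b' c' d')"
  show "(a - a') * (d - d') - (b - b') * (c - c') = 0"
  proof (cases "line a b c d \<inter> line a' b' c' d' = {}")
    case True
    with inc show ?thesis
      by (auto simp: incident_def parallel_line_iff line_eq_iff)
  next
    case False
    then obtain t where t: "a + t * c = a' + t * c'" "b + t * d = b' + t * d'"
      by (auto simp: line_def)
    then have "a - a' = - t * (c - c')" "b - b' = - t * (d - d')"
      by (simp_all add: algebra_simps)
    then show ?thesis by simp
  qed
next
  assume eq: "(a - a') * (d - d') - (b - b') * (c - c') = 0"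
  consider "c = c'" "d = d'" | "c \<noteq> c'" | "d \<noteq> d'" by blast
  then show "incident (line a b c d) (line a' b' c' d')"
  proof cases
    case 1
    then show ?thesis by (simp add: incident_def parallel_line_iff)
  next
    case 2
    define t where "t = - (a - a') / (c - c')"
    have t: "t * (c - c') = - (a - a')" using 2 by (simp add: t_def)
    then have 1: "a + t * c = a' + t * c'" by algebra
    have "(b + t * d - (b' + t * d')) * (c - c') = 0"
      using t eq by algebra
    with 2 have "b + t * d = b' + t * d'" by simp
    with 1 have "(a + t * c, b + t * d, t) \<in> line a b c d \<inter> line a' b' c' d'"
      by (simp add: mem_line)
    then show ?thesis by (auto simp: incident_def)
  next
    case 3
    define t where "t = - (b - b') / (d - d')"
    have t: "t * (d - d') = - (b - b')" using 3 by (simp add: t_def)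
    then have 1: "b + t * d = b' + t * d'" by algebra
    have "(a + t * c - (a' + t * c')) * (d - d') = 0"
      using t eq by algebra
    with 3 have "a + t * c = a' + t * c'" by simp
    with 1 have "(a + t * c, b + t * d, t) \<in> line a b c d \<inter> line a' b' c' d'"
      by (simp add: mem_line)
    then show ?thesis by (auto simp: incident_def)
  qed
qed

end

theory Submission
  imports Defs "HOL-Computational_Algebra.Polynomial"
begin

text \<open>
  Two lines are incident iff the determinant form of the difference of their coordinate vectors
  vanishes, so a realization is a configuration of points in \<open>\<complex>\<^sup>4\<close> with isotropic edges.

  Upper bound. The growth exponent of a set of points is the polynomial rate at which the space of
  functions of degree at most \<open>m\<close> restricted to it grows with \<open>m\<close>. An algebraically dependent new
  coordinate does not raise it, any other raises it by at most one. A graph all of whose vertex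
  sets satisfy the Laman count has a vertex \<open>v\<close> of degree \<open>d \<le> 3\<close>. The lines meeting
  \<open>d \<le> 2\<close> given distinct lines form a family of dimension at most \<open>4 - d\<close>; for \<open>d = 3\<close> the dimension is
  at most one as soon as two of the given lines are skew. By Henneberg's argument some pair of neighbours can
  be joined by an edge in the graph without \<open>v\<close> preserving the count; the configurations in which
  this pair meets thus lose one dimension, which pays for the larger fibre. Induction gives exponent
  \<open>4n - |E| = 2n + 3\<close>. Finally, if \<open>f\<^sub>i\<close> vanishes on the \<open>i\<close>-th but not on the next member of a
  chain of irreducible sets of length \<open>k\<close>, then the monomials in the \<open>f\<^sub>i\<close> are linearly independent on
  the top one, so \<open>k\<close> is at most the exponent.

  Lower bound. Concurrent lines realize the complete graph and depend on \<open>2n + 3\<close> parameters.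
  Releasing the parameters one by one gives a chain of irreducible closed sets of that length.
\<close>

section \<open>Growth of polynomial functions on a set\<close>

text \<open>The \<open>b i\<close> are arbitrary functions, not members of \<open>P\<close>: below
  they are cut off outside a piece of \<open>S\<close> and divided by functions without zeros on
  \<open>S\<close>.\<close>

definition spanned :: "'a set \<Rightarrow> ('a \<Rightarrow> complex) set \<Rightarrow> nat \<Rightarrow> bool" where
  "spanned S P N \<longleftrightarrow>
    (\<exists>b :: nat \<Rightarrow> 'a \<Rightarrow> complex. \<forall>p\<in>P. \<exists>c. \<forall>x\<in>S. p x = (\<Sum>i<N. c i * b i x))"

lemma spannedI:
  assumes "finite A" "card A \<le> N"
    and "\<And>p. p \<in> P \<Longrightarrow> \<exists>c. \<forall>x\<in>S. p x = (\<Sum>a\<in>A. c a * b a x)"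
  shows "spanned S P N"
proof -
  obtain h where h: "bij_betw h {..<card A} A"
    using ex_bij_betw_nat_finite[OF assms(1)] by (auto simp: atLeast0LessThan)
  \<comment> \<open>Zero functions pad the family indexed by \<open>A\<close> to exactly
    \<open>N\<close> members.\<close>
  let ?b = "\<lambda>i. if i < card A then b (h i) else (\<lambda>_. 0)"
  show ?thesis unfolding spanned_def
  proof (intro exI[of _ ?b] ballI)
    fix p assume "p \<in> P"
    then obtain c where c: "\<forall>x\<in>S. p x = (\<Sum>a\<in>A. c a * b a x)" using assms(3) by blast
    have "p x = (\<Sum>i<N. c (h i) * ?b i x)" if "x \<in> S" for x
    proof -
      have "p x = (\<Sum>i<card A. c (h i) * b (h i) x)"
        using c that by (simp add: sum.reindex_bij_betw[OF h, of "\<lambda>a. c a * b a x"])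
      also have "\<dots> = (\<Sum>i<N. c (h i) * ?b i x)"
        by (rule sum.mono_neutral_cong_left) (use assms(2) in auto)
      finally show ?thesis .
    qed
    then show "\<exists>c. \<forall>x\<in>S. p x = (\<Sum>i<N. c i * ?b i x)" by (intro exI[of _ "\<lambda>i. c (h i)"]) simp
  qed
qed

lemma spanned_mono:
  assumes "spanned S P N" "S' \<subseteq> S" "P' \<subseteq> P" "N \<le> N'"
  shows "spanned S' P' N'"
proof -
  obtain b where b: "\<forall>p\<in>P. \<exists>c. \<forall>x\<in>S. p x = (\<Sum>i<N. c i * b i x)"
    using assms(1) unfolding spanned_def by blast
  show ?thesis
    by (rule spannedI[of "{..<N}" _ _ _ b]) (use b assms(2-4) in \<open>auto, blast\<close>)
qed

text \<open>The family for \<open>A\<close> is extended by zero outside \<open>A\<close>, that for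
  \<open>B\<close> is cut off on \<open>A\<close>. The two then do not interfere.\<close>

lemma spanned_Un:
  assumes "spanned A P N" "spanned B P M"
  shows "spanned (A \<union> B) P (N + M)"
proof -
  obtain b b' where b: "\<forall>p\<in>P. \<exists>c. \<forall>x\<in>A. p x = (\<Sum>i<N. c i * b i x)"
    and b': "\<forall>p\<in>P. \<exists>c. \<forall>x\<in>B. p x = (\<Sum>i<M. c i * b' i x)"
    using assms unfolding spanned_def by blast
  let ?b = "case_sum (\<lambda>i x. if x \<in> A then b i x else 0) (\<lambda>i x. if x \<in> A then 0 else b' i x)"
  show ?thesis
  proof (rule spannedI[of "{..<N} <+> {..<M}" _ _ _ ?b])
    fix p assume "p \<in> P"
    then obtain c c' where c: "\<forall>x\<in>A. p x = (\<Sum>i<N. c i * b i x)"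
      and c': "\<forall>x\<in>B. p x = (\<Sum>i<M. c' i * b' i x)" using b b' by blast
    have "p x = (\<Sum>a\<in>{..<N} <+> {..<M}. case_sum c c' a * ?b a x)" if "x \<in> A \<union> B" for x
      using that c c' by (cases "x \<in> A") (auto simp: sum.Plus)
    then show "\<exists>c. \<forall>x\<in>A \<union> B. p x = (\<Sum>a\<in>{..<N} <+> {..<M}. c a * ?b a x)" by (intro exI[of _ "case_sum c c'"]) simp
  qed (auto simp: card_Plus)
qed

text \<open>The products \<open>b j * g i / h\<close> span, once each coefficient \<open>e i\<close>
  is expanded in the family for \<open>Q\<close>.\<close>

lemma spanned_extend:
  fixes g :: "nat \<Rightarrow> 'a \<Rightarrow> complex"
  assumes "spanned S Q N" and nz: "\<And>x. x \<in> S \<Longrightarrow> h x \<noteq> 0"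
    and ex: "\<And>p. p \<in> P \<Longrightarrow> \<exists>e. (\<forall>i<n. e i \<in> Q) \<and> (\<forall>x\<in>S. h x * p x = (\<Sum>i<n. e i x * g i x))"
  shows "spanned S P (n * N)"
proof -
  obtain b where b: "\<forall>p\<in>Q. \<exists>c. \<forall>x\<in>S. p x = (\<Sum>i<N. c i * b i x)"
    using assms(1) unfolding spanned_def by blast
  let ?b = "\<lambda>(i, j) x. b j x * g i x / h x"
  show ?thesis
  proof (rule spannedI[of "{..<n} \<times> {..<N}" _ _ _ ?b])
    fix p assume "p \<in> P"
    then obtain e where e: "\<forall>i<n. e i \<in> Q" "\<forall>x\<in>S. h x * p x = (\<Sum>i<n. e i x * g i x)"
      using ex by blast
    have "\<forall>i. \<exists>c. i < n \<longrightarrow> (\<forall>x\<in>S. e i x = (\<Sum>j<N. c j * b j x))" using b e(1) by blast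
    then obtain c where c: "\<forall>i<n. \<forall>x\<in>S. e i x = (\<Sum>j<N. c i j * b j x)" unfolding choice_iff by blast
    have "p x = (\<Sum>a\<in>{..<n} \<times> {..<N}. (case a of (i, j) \<Rightarrow> c i j) * ?b a x)" if "x \<in> S" for x
    proof -
      have "p x = (\<Sum>i<n. e i x * g i x) / h x" using e(2) that nz[OF that] by (simp add: field_simps)
      also have "\<dots> = (\<Sum>i<n. (\<Sum>j<N. c i j * b j x) * g i x) / h x" using c that by simp
      also have "\<dots> = (\<Sum>i<n. \<Sum>j<N. c i j * (b j x * g i x / h x))"
        by (simp add: sum_divide_distrib sum_distrib_right mult.assoc)
      finally show ?thesis by (simp add: sum.cartesian_product case_prod_unfold)
    qed
    then show "\<exists>c. \<forall>x\<in>S. p x = (\<Sum>a\<in>{..<n} \<times> {..<N}. c a * ?b a x)" by (intro exI[of _ "\<lambda>(i, j). c i j"]) simp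
  qed auto
qed

section \<open>Polynomials of bounded degree in given functions\<close>

text \<open>The number \<open>m\<close> is only an upper bound for the degree. The generators may be
  any functions, algebraically dependent or not; differences of coordinates occur below.\<close>

inductive poly_deg :: "('a \<Rightarrow> complex) set \<Rightarrow> nat \<Rightarrow> ('a \<Rightarrow> complex) \<Rightarrow> bool"
  for F :: "('a \<Rightarrow> complex) set" where
  const: "poly_deg F m (\<lambda>_. c)"
| gen: "f \<in> F \<Longrightarrow> poly_deg F (Suc m) f"
| add: "poly_deg F m p \<Longrightarrow> poly_deg F m q \<Longrightarrow> poly_deg F m (\<lambda>x. p x + q x)"
| mult: "poly_deg F m p \<Longrightarrow> poly_deg F k q \<Longrightarrow> poly_deg F (m + k) (\<lambda>x. p x * q x)"

lemma poly_deg_le: "poly_deg F m p \<Longrightarrow> m \<le> m' \<Longrightarrow> poly_deg F m' p"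
proof (induction arbitrary: m' rule: poly_deg.induct)
  case (gen f m)
  then show ?case using poly_deg.gen[OF gen(1)] by (cases m') auto
next
  case (mult m p k q)
  then have "poly_deg F ((m' - k) + k) (\<lambda>x. p x * q x)" by (intro poly_deg.mult) auto
  then show ?case using mult by simp
qed (auto intro: poly_deg.intros)

lemma poly_deg_gens_mono: "poly_deg F m p \<Longrightarrow> F \<subseteq> F' \<Longrightarrow> poly_deg F' m p"
  by (induction rule: poly_deg.induct) (auto intro: poly_deg.intros)

lemma poly_deg_sum:
  "(\<And>a. a \<in> A \<Longrightarrow> poly_deg F m (f a)) \<Longrightarrow> poly_deg F m (\<lambda>x. \<Sum>a\<in>A. f a x)"
  by (induction A rule: infinite_finite_induct) (auto intro: poly_deg.intros)

lemma poly_deg_power: "poly_deg F m p \<Longrightarrow> poly_deg F (j * m) (\<lambda>x. p x ^ j)"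
  by (induction j) (auto intro: poly_deg.intros)

lemma poly_deg_minus: "poly_deg F m p \<Longrightarrow> poly_deg F m (\<lambda>x. - p x)"
  using poly_deg.mult[OF poly_deg.const[of F 0 "-1"], of m p] by simp

lemma poly_deg_diff: "poly_deg F m p \<Longrightarrow> poly_deg F m q \<Longrightarrow> poly_deg F m (\<lambda>x. p x - q x)"
  using poly_deg.add[OF _ poly_deg_minus, of F m p q] by simp

lemma poly_deg_mult_le:
  "poly_deg F m p \<Longrightarrow> poly_deg F k q \<Longrightarrow> m + k \<le> l \<Longrightarrow> poly_deg F l (\<lambda>x. p x * q x)"
  using poly_deg.mult poly_deg_le by blast

definition palg :: "('a \<Rightarrow> complex) set \<Rightarrow> ('a \<Rightarrow> complex) set" where
  "palg F = {p. \<exists>m. poly_deg F m p}"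

lemma palg_common_degree:
  assumes "finite A" "\<And>a. a \<in> A \<Longrightarrow> f a \<in> palg F"
  obtains m where "\<And>a. a \<in> A \<Longrightarrow> poly_deg F m (f a)"
proof -
  obtain d where d: "\<And>a. a \<in> A \<Longrightarrow> poly_deg F (d a) (f a)"
    using assms(2) unfolding palg_def by simp metis
  have "poly_deg F (\<Sum>a\<in>A. d a) (f a)" if "a \<in> A" for a
    using d[OF that] by (rule poly_deg_le) (simp add: assms(1) that member_le_sum)
  then show thesis by (rule that)
qed

lemma palg_const: "(\<lambda>_. c) \<in> palg F"
  unfolding palg_def by (auto intro: poly_deg.const)

lemma palg_gen: "f \<in> F \<Longrightarrow> f \<in> palg F"
  unfolding palg_def by (auto intro: poly_deg.gen)

lemma palg_add:
  assumes "p \<in> palg F" "q \<in> palg F" shows "(\<lambda>x. p x + q x) \<in> palg F"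
proof -
  obtain a b where "poly_deg F a p" "poly_deg F b q" using assms unfolding palg_def by auto
  then have "poly_deg F (a + b) (\<lambda>x. p x + q x)" by (intro poly_deg.add) (auto intro: poly_deg_le)
  then show ?thesis unfolding palg_def by auto
qed

lemma palg_mult: "p \<in> palg F \<Longrightarrow> q \<in> palg F \<Longrightarrow> (\<lambda>x. p x * q x) \<in> palg F"
  unfolding palg_def by (auto intro: poly_deg.mult)

lemma palg_minus: "p \<in> palg F \<Longrightarrow> (\<lambda>x. - p x) \<in> palg F"
  unfolding palg_def by (auto intro: poly_deg_minus)

lemma palg_diff: "p \<in> palg F \<Longrightarrow> q \<in> palg F \<Longrightarrow> (\<lambda>x. p x - q x) \<in> palg F"
  using palg_add[OF _ palg_minus, of p F q] by simp

lemma palg_power: "p \<in> palg F \<Longrightarrow> (\<lambda>x. p x ^ k) \<in> palg F"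
  unfolding palg_def by (auto intro: poly_deg_power)

lemmas palg_intros = palg_const palg_add palg_mult palg_minus palg_diff palg_power

lemma palg_gens_mono: "p \<in> palg F \<Longrightarrow> F \<subseteq> F' \<Longrightarrow> p \<in> palg F'"
  unfolding palg_def by (auto intro: poly_deg_gens_mono)

lemma palg_insert: "p \<in> palg F \<Longrightarrow> p \<in> palg (insert f F)"
  by (rule palg_gens_mono) auto

text \<open>Powers of \<open>y\<close> are collected, products by the Cauchy formula. The vanishing
  of the coefficients beyond \<open>m\<close> is carried along because
  \<open>polynomial_product\<close> asks for it.\<close>

lemma poly_deg_insert_expand:
  assumes "poly_deg (insert y F) m p"
  shows "\<exists>e. (\<forall>j. poly_deg F m (e j)) \<and> (\<forall>j>m. e j = (\<lambda>_. 0)) \<and> (\<forall>x. p x = (\<Sum>j\<le>m. e j x * y x ^ j))"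
  using assms
proof (induction rule: poly_deg.induct)
  case (const m c)
  have "(\<Sum>j\<le>m. (if j = 0 then \<lambda>_. c else (\<lambda>_. 0)) x * y x ^ j) = c" for x
    by (subst sum.remove[of _ 0]) auto
  then show ?case
    by (intro exI[of _ "\<lambda>j. if j = 0 then \<lambda>_. c else (\<lambda>_. 0)"]) (auto intro: poly_deg.const)
next
  case (gen f m)
  show ?case
  proof (cases "f \<in> F")
    case True
    have "(\<Sum>j\<le>Suc m. (if j = 0 then f else (\<lambda>_. 0)) x * y x ^ j) = f x" for x
      by (subst sum.remove[of _ 0]) auto
    then show ?thesis using True
      by (intro exI[of _ "\<lambda>j. if j = 0 then f else (\<lambda>_. 0)"]) (auto intro: poly_deg.intros)
  next
    case False
    then have "f = y" using gen by auto
    moreover have "(\<Sum>j\<le>Suc m. (if j = 1 then (\<lambda>_. 1) else (\<lambda>_. 0)) x * y x ^ j) = y x" for x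
      by (subst sum.remove[of _ 1]) auto
    ultimately show ?thesis
      by (intro exI[of _ "\<lambda>j. if j = 1 then (\<lambda>_. 1) else (\<lambda>_. 0)"]) (auto intro: poly_deg.intros)
  qed
next
  case (add m p q)
  then obtain e e' where
    "\<forall>j. poly_deg F m (e j)" "\<forall>j>m. e j = (\<lambda>_. 0)" "\<forall>x. p x = (\<Sum>j\<le>m. e j x * y x ^ j)"
    "\<forall>j. poly_deg F m (e' j)" "\<forall>j>m. e' j = (\<lambda>_. 0)" "\<forall>x. q x = (\<Sum>j\<le>m. e' j x * y x ^ j)"
    by blast
  then show ?case
    by (intro exI[of _ "\<lambda>j x. e j x + e' j x"])
       (auto intro: poly_deg.add simp: sum.distrib algebra_simps)
next
  case (mult m p k q)
  then obtain e e' where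
    e: "\<forall>j. poly_deg F m (e j)" "\<forall>j>m. e j = (\<lambda>_. 0)" "\<forall>x. p x = (\<Sum>j\<le>m. e j x * y x ^ j)"
    and e': "\<forall>j. poly_deg F k (e' j)" "\<forall>j>k. e' j = (\<lambda>_. 0)" "\<forall>x. q x = (\<Sum>j\<le>k. e' j x * y x ^ j)"
    by blast
  let ?e = "\<lambda>r x. \<Sum>i\<le>r. e i x * e' (r - i) x"
  have "?e r = (\<lambda>_. 0)" if "r > m + k" for r
  proof -
    have "i > m \<or> r - i > k" if "i \<le> r" for i using \<open>r > m + k\<close> that by linarith
    then have "e i x * e' (r - i) x = 0" if "i \<le> r" for i x using e(2) e'(2) that by fastforce
    then show ?thesis by (intro ext sum.neutral) simp
  qed
  moreover have "p x * q x = (\<Sum>r\<le>m + k. ?e r x * y x ^ r)" for x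
    unfolding e(3)[rule_format] e'(3)[rule_format]
    by (rule polynomial_product) (use e(2) e'(2) in auto)
  moreover have "poly_deg F (m + k) (?e r)" for r
    using e(1) e'(1) by (intro poly_deg_sum poly_deg.mult) auto
  ultimately show ?case by (intro exI[of _ ?e]) auto
qed

section \<open>Growth exponents\<close>

text \<open>The constant \<open>C\<close> absorbs finite unions of sets and bounded rescalings of
  the degree, so that only the exponent matters. \<open>Suc m\<close> keeps the bound from
  collapsing at \<open>m = 0\<close>.\<close>

definition growth_le :: "('a \<Rightarrow> complex) set \<Rightarrow> 'a set \<Rightarrow> nat \<Rightarrow> bool" where
  "growth_le F S k \<longleftrightarrow> (\<exists>C. \<forall>m. spanned S {p. poly_deg F m p} (C * Suc m ^ k))"

lemma growth_le_mono:
  assumes "growth_le F S k" "F' \<subseteq> F" "S' \<subseteq> S" "k \<le> k'"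
  shows "growth_le F' S' k'"
proof -
  obtain C where C: "\<And>m. spanned S {p. poly_deg F m p} (C * Suc m ^ k)"
    using assms(1) unfolding growth_le_def by blast
  have "spanned S' {p. poly_deg F' m p} (C * Suc m ^ k')" for m
    using C by (rule spanned_mono)
      (use assms(2-4) poly_deg_gens_mono in \<open>auto intro: power_increasing simp del: power_Suc\<close>)
  then show ?thesis unfolding growth_le_def by blast
qed

lemma growth_le_Un:
  assumes "growth_le F A k" "growth_le F B k"
  shows "growth_le F (A \<union> B) k"
proof -
  obtain C D where "\<And>m. spanned A {p. poly_deg F m p} (C * Suc m ^ k)"
    "\<And>m. spanned B {p. poly_deg F m p} (D * Suc m ^ k)"
    using assms unfolding growth_le_def by blast
  then have "spanned (A \<union> B) {p. poly_deg F m p} ((C + D) * Suc m ^ k)" for m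
    unfolding distrib_right by (rule spanned_Un)
  then show ?thesis unfolding growth_le_def by blast
qed

lemma growth_le_split:
  assumes "growth_le F {x \<in> S. P x} k" "growth_le F {x \<in> S. \<not> P x} k"
  shows "growth_le F S k"
  using growth_le_Un[OF assms] by (rule growth_le_mono) auto

lemma growth_le_empty: "growth_le F {} k"
  unfolding growth_le_def spanned_def by auto

lemma growth_le_no_gens: "growth_le {} S 0"
proof -
  have "\<exists>c. \<forall>x. p x = c" if "poly_deg {} m p" for m and p :: "'a \<Rightarrow> complex"
    using that by (induction rule: poly_deg.induct) auto
  then have "\<exists>c :: unit \<Rightarrow> complex. \<forall>x\<in>S. p x = (\<Sum>a\<in>{()}. c a * 1)"
    if "p \<in> {p. poly_deg {} m p}" for m and p :: "'a \<Rightarrow> complex"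
  proof -
    from that \<open>\<And>m p. poly_deg {} m p \<Longrightarrow> \<exists>c. \<forall>x. p x = c\<close> obtain c where "\<forall>x. p x = c" by blast
    then show ?thesis by (intro exI[of _ "\<lambda>_. c"]) simp
  qed
  then have "spanned S {p. poly_deg {} m p} (1 * Suc m ^ 0)" for m
    by (intro spannedI[of "{()}" _ _ _ "\<lambda>_ _. 1"]) auto
  then show ?thesis unfolding growth_le_def by blast
qed

text \<open>If the new generators have degree at most \<open>D\<close> in the old ones, degree
  \<open>m\<close> becomes \<open>D * m\<close>, at the cost of a factor
  \<open>Suc D ^ k\<close>.\<close>

lemma growth_le_subst:
  assumes "growth_le F S k" "finite F'" "\<And>f. f \<in> F' \<Longrightarrow> f \<in> palg F"
  shows "growth_le F' S k"
proof -
  obtain D where D: "\<And>f. f \<in> F' \<Longrightarrow> poly_deg F D f"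
    using palg_common_degree[OF assms(2), of "\<lambda>f. f" F] assms(3) by metis
  have sub: "poly_deg F (D * m) p" if "poly_deg F' m p" for m p
    using that
  proof (induction rule: poly_deg.induct)
    case (gen f m)
    then show ?case using D poly_deg_le by (metis le_add1 mult_Suc_right)
  next
    case (mult m p k q)
    then show ?case by (simp add: distrib_left poly_deg.mult)
  qed (auto intro: poly_deg.intros)
  obtain C where C: "\<And>m. spanned S {p. poly_deg F m p} (C * Suc m ^ k)"
    using assms(1) unfolding growth_le_def by blast
  have "spanned S {p. poly_deg F' m p} (C * Suc D ^ k * Suc m ^ k)" for m
    using C[of "D * m"]
  proof (rule spanned_mono)
    have "Suc (D * m) ^ k \<le> (Suc D * Suc m) ^ k" by (intro power_mono) auto
    then have "C * Suc (D * m) ^ k \<le> C * (Suc D * Suc m) ^ k" by (rule mult_le_mono2)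
    then show "C * Suc (D * m) ^ k \<le> C * Suc D ^ k * Suc m ^ k"
      by (simp only: power_mult_distrib mult.assoc)
  qed (use sub in auto)
  then show ?thesis unfolding growth_le_def by blast
qed

text \<open>The expansion in powers of \<open>y\<close> has \<open>Suc m\<close> coefficients, each
  from a space of dimension at most \<open>C * Suc m ^ k\<close>.\<close>

lemma growth_le_insert:
  assumes "growth_le F S k"
  shows "growth_le (insert y F) S (Suc k)"
proof -
  obtain C where C: "\<And>m. spanned S {p. poly_deg F m p} (C * Suc m ^ k)"
    using assms unfolding growth_le_def by blast
  have "spanned S {p. poly_deg (insert y F) m p} (Suc m * (C * Suc m ^ k))" for m
  proof (rule spanned_extend[OF C, where h = "\<lambda>_. 1" and g = "\<lambda>j x. y x ^ j"])
    fix p assume "p \<in> {p. poly_deg (insert y F) m p}"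
    then show "\<exists>e. (\<forall>i<Suc m. e i \<in> {p. poly_deg F m p}) \<and>
        (\<forall>x\<in>S. 1 * p x = (\<Sum>i<Suc m. e i x * y x ^ i))"
      using poly_deg_insert_expand[of y F m p] unfolding lessThan_Suc_atMost by auto
  qed auto
  then show ?thesis unfolding growth_le_def by (intro exI[of _ C]) (simp add: mult_ac)
qed

text \<open>Multiplying an expansion by \<open>c (Suc d) * y\<close> creates one term with
  \<open>y ^ Suc d\<close>, which the relation turns into lower powers. The factor
  \<open>c (Suc d)\<close> avoids division, and each step adds only \<open>D\<close> to the
  degree.\<close>

lemma power_reduce:
  fixes c :: "nat \<Rightarrow> 'a \<Rightarrow> complex"
  assumes deg: "\<And>i. i \<le> Suc d \<Longrightarrow> poly_deg F D (c i)"
    and rel: "\<And>x. x \<in> S \<Longrightarrow> (\<Sum>i\<le>Suc d. c i x * y x ^ i) = 0"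
  shows "\<exists>e. (\<forall>i\<le>d. poly_deg F (j * D) (e i)) \<and>
    (\<forall>x\<in>S. (c (Suc d) x * y x) ^ j = (\<Sum>i\<le>d. e i x * y x ^ i))"
proof (induction j)
  case 0
  have "(\<Sum>i\<le>d. (if i = 0 then (\<lambda>_. 1) else (\<lambda>_. 0)) x * y x ^ i) = 1" for x
    by (subst sum.remove[of _ 0]) auto
  then show ?case
    by (intro exI[of _ "\<lambda>i. if i = 0 then (\<lambda>_. 1) else (\<lambda>_. 0)"]) (auto intro: poly_deg.const)
next
  case (Suc j)
  then obtain e where e: "\<forall>i\<le>d. poly_deg F (j * D) (e i)"
    "\<forall>x\<in>S. (c (Suc d) x * y x) ^ j = (\<Sum>i\<le>d. e i x * y x ^ i)" by blast
  \<comment> \<open>The first summand is the shift by one power; the second comes from replacing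
    \<open>c (Suc d) x * y x ^ Suc d\<close> by the relation.\<close>
  define e' where "e' i x = (if i = 0 then 0 else c (Suc d) x * e (i - 1) x) - e d x * c i x" for i x
  have "poly_deg F (Suc j * D) (e' i)" if "i \<le> d" for i
  proof -
    have 1: "poly_deg F (Suc j * D) (\<lambda>x. e d x * c i x)"
      using e(1) deg that by (intro poly_deg_mult_le[of F "j * D" _ D]) auto
    have 2: "poly_deg F (Suc j * D) (\<lambda>x. c (Suc d) x * e (i - 1) x)"
      using e(1) deg that by (intro poly_deg_mult_le[of F D _ "j * D"]) auto
    show ?thesis unfolding e'_def
      using poly_deg_diff[OF poly_deg.const[of F _ 0] 1] poly_deg_diff[OF 2 1] by (cases "i = 0") simp_all
  qed
  moreover have "(c (Suc d) x * y x) ^ Suc j = (\<Sum>i\<le>d. e' i x * y x ^ i)" if "x \<in> S" for x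
  proof -
    have top: "c (Suc d) x * y x ^ Suc d = - (\<Sum>i\<le>d. c i x * y x ^ i)"
      using rel[OF that] by (simp add: add_eq_0_iff)
    have "(c (Suc d) x * y x) ^ Suc j = (\<Sum>i\<le>d. e i x * y x ^ i) * (c (Suc d) x * y x)"
      using e(2) that by (simp add: mult.commute)
    also have "\<dots> = (\<Sum>i<d. c (Suc d) x * e i x * y x ^ Suc i) + e d x * (c (Suc d) x * y x ^ Suc d)"
      by (simp add: lessThan_Suc_atMost[symmetric] distrib_right distrib_left sum_distrib_left
          sum_distrib_right mult_ac)
    also have "(\<Sum>i<d. c (Suc d) x * e i x * y x ^ Suc i)
        = (\<Sum>i\<le>d. (if i = 0 then 0 else c (Suc d) x * e (i - 1) x) * y x ^ i)"
      unfolding lessThan_Suc_atMost[symmetric] by (subst sum.lessThan_Suc_shift) simp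
    also have "\<dots> + e d x * (c (Suc d) x * y x ^ Suc d) = (\<Sum>i\<le>d. e' i x * y x ^ i)"
      unfolding top e'_def by (simp add: sum_distrib_left sum_subtractf left_diff_distrib mult.assoc)
    finally show ?thesis .
  qed
  ultimately show ?case by blast
qed

text \<open>After multiplication by the \<open>m\<close>-th power of the leading coefficient all
  powers of \<open>y\<close> up to \<open>m\<close> reduce to those up to \<open>d\<close>. The
  number of coefficients stays \<open>Suc d\<close> for every \<open>m\<close>, and their degrees
  grow linearly in \<open>m\<close>.\<close>

lemma growth_le_algebraic_lead:
  fixes c :: "nat \<Rightarrow> 'a \<Rightarrow> complex"
  assumes "growth_le F S k" and c: "\<And>i. i \<le> Suc d \<Longrightarrow> c i \<in> palg F"
    and rel: "\<And>x. x \<in> S \<Longrightarrow> (\<Sum>i\<le>Suc d. c i x * y x ^ i) = 0"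
    and lead: "\<And>x. x \<in> S \<Longrightarrow> c (Suc d) x \<noteq> 0"
  shows "growth_le (insert y F) S k"
proof -
  obtain D where D: "\<And>i. i \<le> Suc d \<Longrightarrow> poly_deg F D (c i)"
    using palg_common_degree[of "{..Suc d}" c F] c by auto
  obtain e where e: "\<And>i j. i \<le> d \<Longrightarrow> poly_deg F (j * D) (e j i)"
      "\<And>j x. x \<in> S \<Longrightarrow> (c (Suc d) x * y x) ^ j = (\<Sum>i\<le>d. e j i x * y x ^ i)"
    using power_reduce[OF D rel] by metis
  obtain C where C: "\<And>m. spanned S {p. poly_deg F m p} (C * Suc m ^ k)"
    using assms(1) unfolding growth_le_def by blast
  have "spanned S {p. poly_deg (insert y F) m p} (Suc d * (C * Suc (m + m * D) ^ k))" for m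
  proof (rule spanned_extend[OF C, where h = "\<lambda>x. c (Suc d) x ^ m" and g = "\<lambda>i x. y x ^ i"])
    fix p assume "p \<in> {p. poly_deg (insert y F) m p}"
    then obtain a where a: "\<forall>j. poly_deg F m (a j)" "\<forall>x. p x = (\<Sum>j\<le>m. a j x * y x ^ j)"
      using poly_deg_insert_expand[of y F m p] by auto
    let ?e = "\<lambda>i x. \<Sum>j\<le>m. a j x * (c (Suc d) x ^ (m - j) * e j i x)"
    have "poly_deg F (m + m * D) (?e i)" if "i < Suc d" for i
    proof (intro poly_deg_sum poly_deg.mult)
      fix j assume "j \<in> {..m}"
      then have "(m - j) * D + j * D \<le> m * D" by (simp add: distrib_right[symmetric])
      then show "poly_deg F (m * D) (\<lambda>x. c (Suc d) x ^ (m - j) * e j i x)"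
        using that by (intro poly_deg_mult_le[OF poly_deg_power[OF D] e(1)]) auto
    qed (use a in auto)
    moreover have "c (Suc d) x ^ m * p x = (\<Sum>i<Suc d. ?e i x * y x ^ i)" if "x \<in> S" for x
    proof -
      have "c (Suc d) x ^ m * p x = (\<Sum>j\<le>m. a j x * c (Suc d) x ^ (m - j) * (c (Suc d) x * y x) ^ j)"
        unfolding a(2)[rule_format] sum_distrib_left
      proof (rule sum.cong)
        fix j assume "j \<in> {..m}"
        then have "c (Suc d) x ^ m = c (Suc d) x ^ (m - j) * c (Suc d) x ^ j"
          by (simp flip: power_add)
        then show "c (Suc d) x ^ m * (a j x * y x ^ j)
            = a j x * c (Suc d) x ^ (m - j) * (c (Suc d) x * y x) ^ j"
          by (simp add: power_mult_distrib)
      qed simp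
      also have "\<dots> = (\<Sum>j\<le>m. \<Sum>i\<le>d. a j x * c (Suc d) x ^ (m - j) * (e j i x * y x ^ i))"
        unfolding e(2)[OF that] by (simp add: sum_distrib_left)
      also have "\<dots> = (\<Sum>i\<le>d. ?e i x * y x ^ i)"
        by (subst sum.swap) (simp add: sum_distrib_right mult.assoc)
      finally show ?thesis by (simp only: lessThan_Suc_atMost)
    qed
    ultimately show "\<exists>e. (\<forall>i<Suc d. e i \<in> {p. poly_deg F (m + m * D) p}) \<and>
        (\<forall>x\<in>S. c (Suc d) x ^ m * p x = (\<Sum>i<Suc d. e i x * y x ^ i))"
      by (intro exI[of _ ?e]) auto
  qed (use lead in auto)
  moreover have "Suc d * (C * Suc (m + m * D) ^ k) \<le> Suc d * C * Suc D ^ k * Suc m ^ k" for m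
  proof -
    have "Suc (m + m * D) ^ k \<le> (Suc D * Suc m) ^ k" by (intro power_mono) auto
    then have "Suc d * C * Suc (m + m * D) ^ k \<le> Suc d * C * (Suc D * Suc m) ^ k"
      by (rule mult_le_mono2)
    then show ?thesis by (simp only: power_mult_distrib mult.assoc)
  qed
  ultimately have "spanned S {p. poly_deg (insert y F) m p} (Suc d * C * Suc D ^ k * Suc m ^ k)" for m
    using spanned_mono[OF _ order_refl order_refl] by blast
  then show ?thesis unfolding growth_le_def by blast
qed

text \<open>Where the top coefficient is nonzero \<open>growth_le_algebraic_lead\<close> applies;
  where it vanishes the relation has smaller formal degree.\<close>

lemma growth_le_algebraic:
  fixes c :: "nat \<Rightarrow> 'a \<Rightarrow> complex"
  assumes "growth_le F S k" and "\<And>i. i \<le> d \<Longrightarrow> c i \<in> palg F"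
    and "\<And>x. x \<in> S \<Longrightarrow> (\<Sum>i\<le>d. c i x * y x ^ i) = 0"
    and "\<And>x. x \<in> S \<Longrightarrow> \<exists>i\<le>d. c i x \<noteq> 0"
  shows "growth_le (insert y F) S k"
  using assms
proof (induction d arbitrary: S)
  case 0
  \<comment> \<open>For \<open>d = 0\<close> the relation reads \<open>c 0 x = 0\<close>, against
    the last assumption.\<close>
  then have "S = {}" by fastforce
  then show ?case by (simp add: growth_le_empty)
next
  case (Suc d)
  show ?case
  proof (rule growth_le_split[of _ _ "\<lambda>x. c (Suc d) x \<noteq> 0"])
    show "growth_le (insert y F) {x \<in> S. c (Suc d) x \<noteq> 0} k"
      by (rule growth_le_algebraic_lead[where c = c and d = d])
         (use Suc.prems in \<open>auto intro: growth_le_mono[OF Suc.prems(1)]\<close>)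
    show "growth_le (insert y F) {x \<in> S. \<not> c (Suc d) x \<noteq> 0} k"
    proof (rule Suc.IH)
      show "\<exists>i\<le>d. c i x \<noteq> 0" if "x \<in> {x \<in> S. \<not> c (Suc d) x \<noteq> 0}" for x
        using Suc.prems(4)[of x] that by (auto simp: le_Suc_eq)
      show "(\<Sum>i\<le>d. c i x * y x ^ i) = 0" if "x \<in> {x \<in> S. \<not> c (Suc d) x \<noteq> 0}" for x
        using Suc.prems(3)[of x] that by auto
    qed (use Suc.prems in \<open>auto intro: growth_le_mono[OF Suc.prems(1)]\<close>)
  qed
qed

section \<open>Lines meeting given lines\<close>

lemma growth_le_linear:
  assumes "growth_le F S k" "c \<in> palg F" "e \<in> palg F"
    and "\<And>x. x \<in> S \<Longrightarrow> c x \<noteq> 0" "\<And>x. x \<in> S \<Longrightarrow> c x * y x = e x"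
  shows "growth_le (insert y F) S k"
proof (rule growth_le_algebraic[where d = 1 and c = "\<lambda>i. if i = 0 then (\<lambda>x. - e x) else c"])
  show "(if i = 0 then \<lambda>x. - e x else c) \<in> palg F" for i :: nat
    using assms(2,3) by (simp add: palg_minus)
  show "(\<Sum>i\<le>1::nat. (if i = 0 then \<lambda>x. - e x else c) x * y x ^ i) = 0" if "x \<in> S" for x
    using assms(5)[OF that] by simp
  show "\<exists>i\<le>1::nat. (if i = 0 then \<lambda>x. - e x else c) x \<noteq> 0" if "x \<in> S" for x
    using assms(4)[OF that] by (intro exI[of _ 1]) simp
qed (fact assms(1))

lemma growth_le_quadratic:
  assumes "growth_le F S k" "a \<in> palg F" "b \<in> palg F" "c \<in> palg F"
    and nz: "\<And>x. x \<in> S \<Longrightarrow> a x \<noteq> 0 \<or> b x \<noteq> 0 \<or> c x \<noteq> 0"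
    and rel: "\<And>x. x \<in> S \<Longrightarrow> a x * y x ^ 2 + b x * y x + c x = 0"
  shows "growth_le (insert y F) S k"
proof -
  let ?c = "\<lambda>i::nat. if i = 0 then c else if i = 1 then b else a"
  show ?thesis
  proof (rule growth_le_algebraic[where d = 2 and c = ?c])
    show "(\<Sum>i\<le>2. ?c i x * y x ^ i) = 0" if "x \<in> S" for x
      using rel[OF that] by (simp add: numeral_2_eq_2 algebra_simps)
    show "\<exists>i\<le>2. ?c i x \<noteq> 0" if "x \<in> S" for x
    proof -
      have "?c 0 x \<noteq> 0 \<or> ?c 1 x \<noteq> 0 \<or> ?c 2 x \<noteq> 0" using nz[OF that] by auto
      moreover have "0 \<le> (2::nat)" "1 \<le> (2::nat)" "2 \<le> (2::nat)" by auto
      ultimately show ?thesis by blast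
    qed
  qed (use assms(1-4) in auto)
qed

text \<open>The relation is quadratic in \<open>y\<close> over \<open>z\<close> and makes
  \<open>y\<close> algebraic unless all its coefficients vanish. In that case \<open>a = 0\<close>,
  so \<open>b\<close> or \<open>c\<close> is nonzero, \<open>z\<close> itself is algebraic and only
  \<open>y\<close> remains free.\<close>

lemma growth_le_conic:
  assumes g: "growth_le F S k"
    and coeffs: "a \<in> palg F" "b \<in> palg F" "c \<in> palg F" "d \<in> palg F" "e \<in> palg F" "f \<in> palg F"
    and nz: "\<And>x. x \<in> S \<Longrightarrow> a x \<noteq> 0 \<or> b x \<noteq> 0 \<or> c x \<noteq> 0"
    and rel: "\<And>x. x \<in> S \<Longrightarrow>
      a x * y x ^ 2 + b x * y x * z x + c x * z x ^ 2 + d x * y x + e x * z x + f x = 0"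
  shows "growth_le (insert y (insert z F)) S (Suc k)"
proof (rule growth_le_split)
  let ?P = "\<lambda>x. a x \<noteq> 0 \<or> b x * z x + d x \<noteq> 0 \<or> c x * z x ^ 2 + e x * z x + f x \<noteq> 0"
  have g': "growth_le F S' k" if "S' \<subseteq> S" for S' using g that by (auto intro: growth_le_mono)
  have z: "z \<in> palg (insert z F)" by (simp add: palg_gen)
  show "growth_le (insert y (insert z F)) {x \<in> S. ?P x} (Suc k)"
  proof (rule growth_le_quadratic[of _ _ _ a "\<lambda>x. b x * z x + d x" "\<lambda>x. c x * z x ^ 2 + e x * z x + f x"])
    show "growth_le (insert z F) {x \<in> S. ?P x} (Suc k)" by (intro growth_le_insert g') auto
    show "a x * y x ^ 2 + (b x * z x + d x) * y x + (c x * z x ^ 2 + e x * z x + f x) = 0"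
      if "x \<in> {x \<in> S. ?P x}" for x
      using rel[of x] that by (simp add: algebra_simps)
    show "(\<lambda>x. b x * z x + d x) \<in> palg (insert z F)"
      by (intro palg_add palg_mult z palg_insert[OF coeffs(2)] palg_insert[OF coeffs(4)])
    show "(\<lambda>x. c x * z x ^ 2 + e x * z x + f x) \<in> palg (insert z F)"
      by (intro palg_add palg_mult palg_power z palg_insert[OF coeffs(3)] palg_insert[OF coeffs(5)]
          palg_insert[OF coeffs(6)])
  qed (use palg_insert[OF coeffs(1)] in auto)
  show "growth_le (insert y (insert z F)) {x \<in> S. \<not> ?P x} (Suc k)"
  proof (rule growth_le_insert, rule growth_le_split[of "insert z F" _ "\<lambda>x. b x \<noteq> 0"])
    show "growth_le (insert z F) {x \<in> {x \<in> S. \<not> ?P x}. b x \<noteq> 0} k"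
      by (rule growth_le_linear[of _ _ _ b "\<lambda>x. - d x"])
         (use coeffs in \<open>auto intro: g' palg_minus simp: add_eq_0_iff\<close>)
    show "growth_le (insert z F) {x \<in> {x \<in> S. \<not> ?P x}. \<not> b x \<noteq> 0} k"
      by (rule growth_le_quadratic[of _ _ _ c e f]) (use coeffs nz in \<open>auto intro: g'\<close>)
  qed
qed

section \<open>Families of lines meeting up to three given lines\<close>

text \<open>Below, \<open>u\<^sub>1 u\<^sub>4 = u\<^sub>2 u\<^sub>3\<close> says that the new line, translated by a neighbour, is isotropic. The
  same condition for a neighbour with difference vector \<open>w\<close> from the first one becomes linear in \<open>u\<close>
  after subtracting the quadratic relation.\<close>

lemma growth_le_fibre2_aux:
  assumes g: "growth_le F S k"
    and w: "w1 \<in> palg F" "w2 \<in> palg F" "w3 \<in> palg F" "w4 \<in> palg F" "r \<in> palg F"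
    and quad: "\<And>x. x \<in> S \<Longrightarrow> u1 x * u4 x = u2 x * u3 x"
    and lin: "\<And>x. x \<in> S \<Longrightarrow> u1 x * w4 x + u4 x * w1 x = u2 x * w3 x + u3 x * w2 x + r x"
    and nz: "\<And>x. x \<in> S \<Longrightarrow> w4 x \<noteq> 0"
  shows "growth_le ({u1, u2, u3, u4} \<union> F) S (k + 2)"
proof -
  \<comment> \<open>This is the coefficient of \<open>u2\<close> after \<open>u1\<close> is
    eliminated from \<open>quad\<close> and \<open>lin\<close>. Where it vanishes, \<open>u3\<close>
    is determined by \<open>u4\<close>, since \<open>w4\<close> has no zero.\<close>
  let ?P = "\<lambda>x. u4 x * w3 x - w4 x * u3 x \<noteq> 0"
  have g': "growth_le F S' k" if "S' \<subseteq> S" for S' using g that by (auto intro: growth_le_mono)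
  have g1: "growth_le (insert u2 (insert u3 (insert u4 F))) {x \<in> S. ?P x} (k + 2)"
  proof (rule growth_le_linear)
    show "growth_le (insert u3 (insert u4 F)) {x \<in> S. ?P x} (k + 2)"
      using growth_le_insert[OF growth_le_insert[OF g']] by simp
    show "(u4 x * w3 x - w4 x * u3 x) * u2 x = u4 x * (u4 x * w1 x - u3 x * w2 x - r x)"
      if "x \<in> {x \<in> S. ?P x}" for x
    proof -
      have "u1 x * u4 x = u2 x * u3 x"
        "u1 x * w4 x + u4 x * w1 x = u2 x * w3 x + u3 x * w2 x + r x" using that quad lin by auto
      then show ?thesis by algebra
    qed
  qed (use w in \<open>auto intro!: palg_intros intro: palg_insert palg_gen\<close>)
  have g2: "growth_le (insert u2 (insert u3 (insert u4 F))) {x \<in> S. \<not> ?P x} (k + 2)"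
  proof -
    have "growth_le (insert u3 (insert u4 F)) {x \<in> S. \<not> ?P x} (k + 1)"
    proof (rule growth_le_linear[where c = w4 and e = "\<lambda>x. u4 x * w3 x"])
      show "growth_le (insert u4 F) {x \<in> S. \<not> ?P x} (k + 1)"
        using growth_le_insert[OF g'] by simp
    qed (use w nz in \<open>auto intro!: palg_mult intro: palg_insert palg_gen\<close>)
    then show ?thesis using growth_le_insert by fastforce
  qed
  have "growth_le (insert u1 (insert u2 (insert u3 (insert u4 F)))) S (k + 2)"
  proof (rule growth_le_linear)
    show "growth_le (insert u2 (insert u3 (insert u4 F))) S (k + 2)"
      using g1 g2 by (rule growth_le_split)
    show "w4 x * u1 x = u2 x * w3 x + u3 x * w2 x + r x - u4 x * w1 x" if "x \<in> S" for x
      using lin[OF that] by (simp add: algebra_simps)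
  qed (use w nz in \<open>auto intro!: palg_intros intro: palg_insert palg_gen\<close>)
  then show ?thesis by (simp add: insert_commute)
qed

text \<open>Symmetries of the form \<open>u1 * u4 - u2 * u3\<close> move any nonzero coordinate of
  \<open>w\<close> to the fourth place. Those that exchange the pairs (1,4) and (2,3) reverse its
  sign, hence that of \<open>r\<close>.\<close>

lemma growth_le_fibre2:
  assumes g: "growth_le F S k"
    and w: "w1 \<in> palg F" "w2 \<in> palg F" "w3 \<in> palg F" "w4 \<in> palg F" "r \<in> palg F"
    and quad: "\<And>x. x \<in> S \<Longrightarrow> u1 x * u4 x = u2 x * u3 x"
    and lin: "\<And>x. x \<in> S \<Longrightarrow> u1 x * w4 x + u4 x * w1 x = u2 x * w3 x + u3 x * w2 x + r x"
    and nz: "\<And>x. x \<in> S \<Longrightarrow> w1 x \<noteq> 0 \<or> w2 x \<noteq> 0 \<or> w3 x \<noteq> 0 \<or> w4 x \<noteq> 0"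
  shows "growth_le ({u1, u2, u3, u4} \<union> F) S (k + 2)"
proof -
  let ?G = "{u1, u2, u3, u4} \<union> F"
  have g': "growth_le F S' k" if "S' \<subseteq> S" for S' using g that by (auto intro: growth_le_mono)
  have 4: "growth_le ?G {x \<in> S. w4 x \<noteq> 0} (k + 2)"
    by (rule growth_le_fibre2_aux[of F _ k w1 w2 w3 w4 r])
       (use w quad lin in \<open>auto intro: g'\<close>)
  have "growth_le ({u4, u2, u3, u1} \<union> F) {x \<in> S. w1 x \<noteq> 0} (k + 2)"
    by (rule growth_le_fibre2_aux[of F _ k w4 w2 w3 w1 r])
       (use w quad lin in \<open>auto intro: g' simp: mult.commute add.commute\<close>)
  then have 1: "growth_le ?G {x \<in> S. w1 x \<noteq> 0} (k + 2)" by (simp add: insert_commute)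
  have "growth_le ({u2, u1, u4, u3} \<union> F) {x \<in> S. w3 x \<noteq> 0} (k + 2)"
    by (rule growth_le_fibre2_aux[of F _ k w2 w1 w4 w3 "\<lambda>x. - r x"])
       (use w quad lin in \<open>auto intro: g' palg_minus\<close>)
  then have 3: "growth_le ?G {x \<in> S. w3 x \<noteq> 0} (k + 2)" by (simp add: insert_commute)
  have "growth_le ({u3, u1, u4, u2} \<union> F) {x \<in> S. w2 x \<noteq> 0} (k + 2)"
    by (rule growth_le_fibre2_aux[of F _ k w3 w1 w4 w2 "\<lambda>x. - r x"])
       (use w quad lin in \<open>auto intro: g' palg_minus simp: mult.commute add.commute\<close>)
  then have 2: "growth_le ?G {x \<in> S. w2 x \<noteq> 0} (k + 2)" by (simp add: insert_commute)
  from growth_le_Un[OF growth_le_Un[OF 1 2] growth_le_Un[OF 3 4]] show ?thesis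
    by (rule growth_le_mono) (use nz in auto)
qed

text \<open>Where \<open>u4\<close> is nonzero, \<open>u1\<close> is determined by the rest; where
  it vanishes, \<open>u4\<close> contributes nothing and the other three are counted as
  free.\<close>

lemma growth_le_fibre1:
  assumes g: "growth_le F S k" and quad: "\<And>x. x \<in> S \<Longrightarrow> u1 x * u4 x = u2 x * u3 x"
  shows "growth_le ({u1, u2, u3, u4} \<union> F) S (k + 3)"
proof -
  have g': "growth_le F S' k" if "S' \<subseteq> S" for S' using g that by (auto intro: growth_le_mono)
  have "growth_le (insert u1 (insert u2 (insert u3 (insert u4 F)))) S (k + 3)"
  proof (rule growth_le_split[of _ _ "\<lambda>x. u4 x \<noteq> 0"])
    have "growth_le (insert u2 (insert u3 (insert u4 F))) {x \<in> S. u4 x \<noteq> 0} (k + 3)"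
      using growth_le_insert[OF growth_le_insert[OF growth_le_insert[OF g']]]
      by (simp add: numeral_3_eq_3)
    then show "growth_le (insert u1 (insert u2 (insert u3 (insert u4 F)))) {x \<in> S. u4 x \<noteq> 0} (k + 3)"
      by (rule growth_le_linear[where c = u4 and e = "\<lambda>x. u2 x * u3 x"])
         (use quad in \<open>auto intro: palg_mult[OF palg_gen palg_gen] palg_gen simp: mult.commute\<close>)
    have "growth_le (insert u4 F) {x \<in> S. \<not> u4 x \<noteq> 0} k"
      by (rule growth_le_linear[where c = "\<lambda>_. 1" and e = "\<lambda>_. 0"]) (auto intro: g' palg_const)
    from growth_le_insert[OF growth_le_insert[OF growth_le_insert[OF this]]]
    show "growth_le (insert u1 (insert u2 (insert u3 (insert u4 F)))) {x \<in> S. \<not> u4 x \<noteq> 0} (k + 3)"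
      by (simp add: numeral_3_eq_3)
  qed
  then show ?thesis by simp
qed

lemma growth_le_fibre0:
  assumes "growth_le F S k"
  shows "growth_le ({u1, u2, u3, u4} \<union> F) S (k + 4)"
  using growth_le_insert[OF growth_le_insert[OF growth_le_insert[OF growth_le_insert[OF assms]]]]
  by (simp add: eval_nat_numeral)

text \<open>Cramer's rule for \<open>u1\<close>, \<open>u2\<close> leaves a conic in
  \<open>u3\<close>, \<open>u4\<close>. If its quadratic part vanished, the plane orthogonal to
  \<open>w\<close> and \<open>v\<close> would be totally isotropic, hence its own orthogonal
  complement. It would then contain \<open>w\<close>, which is not isotropic by
  \<open>skew\<close>.\<close>

lemma growth_le_fibre3_aux12:
  assumes g: "growth_le F S k"
    and w: "w1 \<in> palg F" "w2 \<in> palg F" "w3 \<in> palg F" "w4 \<in> palg F" "r \<in> palg F"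
    and w': "v1 \<in> palg F" "v2 \<in> palg F" "v3 \<in> palg F" "v4 \<in> palg F" "s \<in> palg F"
    and quad: "\<And>x. x \<in> S \<Longrightarrow> u1 x * u4 x = u2 x * u3 x"
    and lin: "\<And>x. x \<in> S \<Longrightarrow> u1 x * w4 x + u4 x * w1 x = u2 x * w3 x + u3 x * w2 x + r x"
    and lin': "\<And>x. x \<in> S \<Longrightarrow> u1 x * v4 x + u4 x * v1 x = u2 x * v3 x + u3 x * v2 x + s x"
    and skew: "\<And>x. x \<in> S \<Longrightarrow> w1 x * w4 x - w2 x * w3 x \<noteq> 0"
    and minor: "\<And>x. x \<in> S \<Longrightarrow> w3 x * v4 x - w4 x * v3 x \<noteq> 0"
  shows "growth_le ({u1, u2, u3, u4} \<union> F) S (k + 1)"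
proof -
  have g34: "growth_le (insert u3 (insert u4 F)) S (Suc k)"
  proof (rule growth_le_conic[OF g])
    show "w2 x * v4 x - w4 x * v2 x \<noteq> 0 \<or> w3 x * v2 x - v3 x * w2 x + w4 x * v1 x - v4 x * w1 x \<noteq> 0
        \<or> w1 x * v3 x - w3 x * v1 x \<noteq> 0" if "x \<in> S" for x
    proof (rule ccontr)
      assume "\<not> ?thesis"
      then have "w2 x * v4 x - w4 x * v2 x = 0" "w1 x * v3 x - w3 x * v1 x = 0"
        "w3 x * v2 x - v3 x * w2 x + w4 x * v1 x - v4 x * w1 x = 0" by auto
      then have "(w3 x * v4 x - w4 x * v3 x) * (w1 x * w4 x - w2 x * w3 x) = 0" by algebra
      then show False using skew[OF that] minor[OF that] by simp
    qed
    show "(w2 x * v4 x - w4 x * v2 x) * (u3 x)\<^sup>2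
        + (w3 x * v2 x - v3 x * w2 x + w4 x * v1 x - v4 x * w1 x) * u3 x * u4 x
        + (w1 x * v3 x - w3 x * v1 x) * (u4 x)\<^sup>2
        + (v4 x * r x - w4 x * s x) * u3 x + (w3 x * s x - v3 x * r x) * u4 x + 0 = 0"
      if "x \<in> S" for x
      using quad[OF that] lin[OF that] lin'[OF that] by algebra
  qed (use w w' in \<open>auto intro!: palg_intros\<close>)
  have g2: "growth_le (insert u2 (insert u3 (insert u4 F))) S (Suc k)"
  proof (rule growth_le_linear[OF g34])
    show "(w3 x * v4 x - w4 x * v3 x) * u2 x
      = w4 x * (v2 x * u3 x - v1 x * u4 x + s x) - v4 x * (w2 x * u3 x - w1 x * u4 x + r x)"
      if "x \<in> S" for x using lin[OF that] lin'[OF that] by algebra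
  qed (use w w' minor in \<open>auto intro!: palg_intros intro: palg_insert palg_gen\<close>)
  have "growth_le (insert u1 (insert u2 (insert u3 (insert u4 F)))) S (Suc k)"
  proof (rule growth_le_linear[OF g2])
    show "(w3 x * v4 x - w4 x * v3 x) * u1 x
      = w3 x * (v2 x * u3 x - v1 x * u4 x + s x) - v3 x * (w2 x * u3 x - w1 x * u4 x + r x)"
      if "x \<in> S" for x using lin[OF that] lin'[OF that] by algebra
  qed (use w w' minor in \<open>auto intro!: palg_intros intro: palg_insert palg_gen\<close>)
  then show ?thesis by simp
qed

text \<open>The same elimination for the minor belonging to \<open>u1\<close> and \<open>u4\<close>,
  with a conic in \<open>u2\<close>, \<open>u3\<close>.\<close>

lemma growth_le_fibre3_aux14:
  assumes g: "growth_le F S k"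
    and w: "w1 \<in> palg F" "w2 \<in> palg F" "w3 \<in> palg F" "w4 \<in> palg F" "r \<in> palg F"
    and w': "v1 \<in> palg F" "v2 \<in> palg F" "v3 \<in> palg F" "v4 \<in> palg F" "s \<in> palg F"
    and quad: "\<And>x. x \<in> S \<Longrightarrow> u1 x * u4 x = u2 x * u3 x"
    and lin: "\<And>x. x \<in> S \<Longrightarrow> u1 x * w4 x + u4 x * w1 x = u2 x * w3 x + u3 x * w2 x + r x"
    and lin': "\<And>x. x \<in> S \<Longrightarrow> u1 x * v4 x + u4 x * v1 x = u2 x * v3 x + u3 x * v2 x + s x"
    and skew: "\<And>x. x \<in> S \<Longrightarrow> w1 x * w4 x - w2 x * w3 x \<noteq> 0"
    and minor: "\<And>x. x \<in> S \<Longrightarrow> w4 x * v1 x - w1 x * v4 x \<noteq> 0"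
  shows "growth_le ({u1, u2, u3, u4} \<union> F) S (k + 1)"
proof -
  \<comment> \<open>These are the Cramer numerators that express \<open>D * u1\<close> and
    \<open>D * u4\<close> through \<open>u2\<close> and \<open>u3\<close>.\<close>
  define A2 A3 A0 B2 B3 B0 where defs: "A2 = (\<lambda>x. v1 x * w3 x - w1 x * v3 x)"
    "A3 = (\<lambda>x. v1 x * w2 x - w1 x * v2 x)" "A0 = (\<lambda>x. v1 x * r x - w1 x * s x)"
    "B2 = (\<lambda>x. w4 x * v3 x - v4 x * w3 x)" "B3 = (\<lambda>x. w4 x * v2 x - v4 x * w2 x)"
    "B0 = (\<lambda>x. w4 x * s x - v4 x * r x)"
  define D where D: "D = (\<lambda>x. w4 x * v1 x - w1 x * v4 x)"
  have alg: "A2 \<in> palg F" "A3 \<in> palg F" "A0 \<in> palg F" "B2 \<in> palg F" "B3 \<in> palg F" "B0 \<in> palg F"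
    "D \<in> palg F"
    unfolding defs D using w w' by (auto intro!: palg_intros)
  have u1: "D x * u1 x = A2 x * u2 x + A3 x * u3 x + A0 x" if "x \<in> S" for x
    unfolding defs D using lin[OF that] lin'[OF that] by algebra
  have u4: "D x * u4 x = B2 x * u2 x + B3 x * u3 x + B0 x" if "x \<in> S" for x
    unfolding defs D using lin[OF that] lin'[OF that] by algebra
  have D0: "D x \<noteq> 0" if "x \<in> S" for x using minor[OF that] by (simp add: D)
  have g23: "growth_le (insert u2 (insert u3 F)) S (Suc k)"
  proof (rule growth_le_conic[OF g])
    show "A2 x * B2 x \<noteq> 0 \<or> A2 x * B3 x + A3 x * B2 x - D x * D x \<noteq> 0 \<or> A3 x * B3 x \<noteq> 0"
      if "x \<in> S" for x
    proof (rule ccontr)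
      assume "\<not> ?thesis"
      then have 0: "A2 x * B2 x = 0" "A3 x * B3 x = 0"
        "A2 x * B3 x + A3 x * B2 x - D x * D x = 0" by auto
      \<comment> \<open>With these expressions and vanishing coefficients, \<open>D x * w2 x\<close>
        and \<open>D x * w3 x\<close> multiply to \<open>D x * D x * w1 x * w4 x\<close>, against
        \<open>skew\<close>.\<close>
      have w3: "D x * w3 x = A2 x * w4 x + B2 x * w1 x" and w2: "D x * w2 x = A3 x * w4 x + B3 x * w1 x"
        unfolding defs D by algebra+
      have "D x * D x * (w1 x * w4 x - w2 x * w3 x) = 0" using 0 w2 w3 by algebra
      then show False using skew[OF that] D0[OF that] by simp
    qed
    show "A2 x * B2 x * (u2 x)\<^sup>2 + (A2 x * B3 x + A3 x * B2 x - D x * D x) * u2 x * u3 x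
        + A3 x * B3 x * (u3 x)\<^sup>2 + (A2 x * B0 x + A0 x * B2 x) * u2 x
        + (A3 x * B0 x + A0 x * B3 x) * u3 x + A0 x * B0 x = 0"
      if "x \<in> S" for x
      using quad[OF that] u1[OF that] u4[OF that] by algebra
  qed (use alg in \<open>auto intro!: palg_intros\<close>)
  have g4: "growth_le (insert u4 (insert u2 (insert u3 F))) S (Suc k)"
    by (rule growth_le_linear[OF g23 _ _ D0 u4])
       (use alg in \<open>auto intro!: palg_add palg_mult intro: palg_insert palg_gen\<close>)
  have "growth_le (insert u1 (insert u4 (insert u2 (insert u3 F)))) S (Suc k)"
    by (rule growth_le_linear[OF g4 _ _ D0 u1])
       (use alg in \<open>auto intro!: palg_add palg_mult intro: palg_insert palg_gen\<close>)
  then show ?thesis by (simp add: insert_commute)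
qed

text \<open>If \<open>v = l w\<close>, the two linear equations are compatible only for \<open>l \<in> {0, 1}\<close>.\<close>

lemma independent_normals:
  fixes w1 :: complex
  assumes lin: "u1 * w4 + u4 * w1 = u2 * w3 + u3 * w2 + (w1 * w4 - w2 * w3)"
    and lin': "u1 * v4 + u4 * v1 = u2 * v3 + u3 * v2 + (v1 * v4 - v2 * v3)"
    and skew: "w1 * w4 - w2 * w3 \<noteq> 0"
    and nz: "v1 \<noteq> 0 \<or> v2 \<noteq> 0 \<or> v3 \<noteq> 0 \<or> v4 \<noteq> 0"
    and ne: "v1 \<noteq> w1 \<or> v2 \<noteq> w2 \<or> v3 \<noteq> w3 \<or> v4 \<noteq> w4"
    and "w1 * v2 = w2 * v1" "w1 * v3 = w3 * v1" "w1 * v4 = w4 * v1"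
      "w2 * v3 = w3 * v2" "w2 * v4 = w4 * v2"
  shows False
proof -
  have "\<exists>l. v1 = l * w1 \<and> v2 = l * w2 \<and> v3 = l * w3 \<and> v4 = l * w4"
  proof (cases "w1 = 0")
    case True
    then have "w2 \<noteq> 0" using skew by auto
    then show ?thesis using assms(6-10) True
      by (intro exI[of _ "v2 / w2"]) (auto simp: field_simps)
  next
    case False
    then show ?thesis using assms(6-10)
      by (intro exI[of _ "v1 / w1"]) (auto simp: field_simps)
  qed
  then obtain l where l: "v1 = l * w1" "v2 = l * w2" "v3 = l * w3" "v4 = l * w4" by blast
  have "l * (l - 1) * (w1 * w4 - w2 * w3) = 0" using lin lin' unfolding l by algebra
  then have "l = 0 \<or> l = 1" using skew by auto
  then show False using nz ne l by auto
qed

text \<open>By \<open>independent_normals\<close> some 2x2 minor of the two linear equations is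
  nonzero. Symmetries of the form reduce four of the minors to \<open>growth_le_fibre3_aux12\<close>
  and the two for the pairs (1,4) and (2,3) to \<open>growth_le_fibre3_aux14\<close>; in case
  \<open>f\<close> the form changes sign.\<close>

lemma growth_le_fibre3:
  assumes g: "growth_le F S k"
    and w: "w1 \<in> palg F" "w2 \<in> palg F" "w3 \<in> palg F" "w4 \<in> palg F"
    and v: "v1 \<in> palg F" "v2 \<in> palg F" "v3 \<in> palg F" "v4 \<in> palg F"
    and quad: "\<And>x. x \<in> S \<Longrightarrow> u1 x * u4 x = u2 x * u3 x"
    and lin: "\<And>x. x \<in> S \<Longrightarrow>
      u1 x * w4 x + u4 x * w1 x = u2 x * w3 x + u3 x * w2 x + (w1 x * w4 x - w2 x * w3 x)"
    and lin': "\<And>x. x \<in> S \<Longrightarrow>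
      u1 x * v4 x + u4 x * v1 x = u2 x * v3 x + u3 x * v2 x + (v1 x * v4 x - v2 x * v3 x)"
    and skew: "\<And>x. x \<in> S \<Longrightarrow> w1 x * w4 x - w2 x * w3 x \<noteq> 0"
    and nz: "\<And>x. x \<in> S \<Longrightarrow> v1 x \<noteq> 0 \<or> v2 x \<noteq> 0 \<or> v3 x \<noteq> 0 \<or> v4 x \<noteq> 0"
    and ne: "\<And>x. x \<in> S \<Longrightarrow> v1 x \<noteq> w1 x \<or> v2 x \<noteq> w2 x \<or> v3 x \<noteq> w3 x \<or> v4 x \<noteq> w4 x"
  shows "growth_le ({u1, u2, u3, u4} \<union> F) S (k + 1)"
proof -
  let ?G = "{u1, u2, u3, u4} \<union> F"
  let ?r = "\<lambda>x. w1 x * w4 x - w2 x * w3 x" and ?s = "\<lambda>x. v1 x * v4 x - v2 x * v3 x"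
  have g': "growth_le F S' k" if "S' \<subseteq> S" for S' using g that by (auto intro: growth_le_mono)
  have rs: "?r \<in> palg F" "?s \<in> palg F" "(\<lambda>x. - ?r x) \<in> palg F" "(\<lambda>x. - ?s x) \<in> palg F"
    by (intro palg_diff palg_mult palg_minus w v)+
  have skew': "w2 x * w3 x \<noteq> w1 x * w4 x" if "x \<in> S" for x using skew[OF that] by simp
  have a: "growth_le ?G {x \<in> S. w3 x * v4 x - w4 x * v3 x \<noteq> 0} (k + 1)"
    by (rule growth_le_fibre3_aux12[of F _ k w1 w2 w3 w4 ?r v1 v2 v3 v4 ?s])
       (use w v rs quad lin lin' skew in \<open>auto intro: g'\<close>)
  have b: "growth_le ({u1, u3, u2, u4} \<union> F) {x \<in> S. w2 x * v4 x - w4 x * v2 x \<noteq> 0} (k + 1)"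
    by (rule growth_le_fibre3_aux12[of F _ k w1 w3 w2 w4 ?r v1 v3 v2 v4 ?s])
       (use w v rs quad lin lin' skew in \<open>auto intro: g' simp: algebra_simps\<close>)
  have c: "growth_le ({u4, u2, u3, u1} \<union> F) {x \<in> S. w3 x * v1 x - w1 x * v3 x \<noteq> 0} (k + 1)"
    by (rule growth_le_fibre3_aux12[of F _ k w4 w2 w3 w1 ?r v4 v2 v3 v1 ?s])
       (use w v rs quad lin lin' skew in \<open>auto intro: g' simp: algebra_simps\<close>)
  have d: "growth_le ({u4, u3, u2, u1} \<union> F) {x \<in> S. w2 x * v1 x - w1 x * v2 x \<noteq> 0} (k + 1)"
    by (rule growth_le_fibre3_aux12[of F _ k w4 w3 w2 w1 ?r v4 v3 v2 v1 ?s])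
       (use w v rs quad lin lin' skew in \<open>auto intro: g' simp: algebra_simps\<close>)
  have e: "growth_le ?G {x \<in> S. w4 x * v1 x - w1 x * v4 x \<noteq> 0} (k + 1)"
    by (rule growth_le_fibre3_aux14[of F _ k w1 w2 w3 w4 ?r v1 v2 v3 v4 ?s])
       (use w v rs quad lin lin' skew in \<open>auto intro: g'\<close>)
  have f: "growth_le ({u2, u1, u4, u3} \<union> F) {x \<in> S. w3 x * v2 x - w2 x * v3 x \<noteq> 0} (k + 1)"
    by (rule growth_le_fibre3_aux14[of F _ k w2 w1 w4 w3 "\<lambda>x. - ?r x" v2 v1 v4 v3 "\<lambda>x. - ?s x"])
       (use w v rs quad lin lin' skew' in \<open>auto intro: g' simp: algebra_simps\<close>)
  have perm: "{u1, u3, u2, u4} = {u1, u2, u3, u4}" "{u4, u2, u3, u1} = {u1, u2, u3, u4}"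
    "{u4, u3, u2, u1} = {u1, u2, u3, u4}" "{u2, u1, u4, u3} = {u1, u2, u3, u4}" by auto
  show ?thesis
    using growth_le_Un[OF growth_le_Un[OF growth_le_Un[OF a b[unfolded perm]]
      growth_le_Un[OF c[unfolded perm] d[unfolded perm]]] growth_le_Un[OF e f[unfolded perm]]]
  proof (rule growth_le_mono)
    show "S \<subseteq> {x \<in> S. w3 x * v4 x - w4 x * v3 x \<noteq> 0} \<union> {x \<in> S. w2 x * v4 x - w4 x * v2 x \<noteq> 0}
       \<union> ({x \<in> S. w3 x * v1 x - w1 x * v3 x \<noteq> 0} \<union> {x \<in> S. w2 x * v1 x - w1 x * v2 x \<noteq> 0})
       \<union> ({x \<in> S. w4 x * v1 x - w1 x * v4 x \<noteq> 0} \<union> {x \<in> S. w3 x * v2 x - w2 x * v3 x \<noteq> 0})"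
    proof (rule subsetI, rule ccontr)
      fix x assume x: "x \<in> S" and "x \<notin> {x \<in> S. w3 x * v4 x - w4 x * v3 x \<noteq> 0}
       \<union> {x \<in> S. w2 x * v4 x - w4 x * v2 x \<noteq> 0}
       \<union> ({x \<in> S. w3 x * v1 x - w1 x * v3 x \<noteq> 0} \<union> {x \<in> S. w2 x * v1 x - w1 x * v2 x \<noteq> 0})
       \<union> ({x \<in> S. w4 x * v1 x - w1 x * v4 x \<noteq> 0} \<union> {x \<in> S. w3 x * v2 x - w2 x * v3 x \<noteq> 0})"
      then show False
        by (intro independent_normals[OF lin[OF x] lin'[OF x] skew[OF x] nz[OF x] ne[OF x]]) auto
    qed
  qed auto
qed

section \<open>Sparse graphs and their realizations\<close>

definition edges_in :: "'v set set \<Rightarrow> 'v set \<Rightarrow> 'v set set" where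
  "edges_in E S = {e \<in> E. e \<subseteq> S}"

text \<open>Dropping the exact edge count makes the class closed under subgraphs, as the induction
  on vertices requires. The additive form avoids truncated subtraction.\<close>

definition laman_sparse :: "'v set \<Rightarrow> 'v set set \<Rightarrow> bool" where
  "laman_sparse V E \<longleftrightarrow> simple_graph V E \<and>
    (\<forall>S\<subseteq>V. 2 \<le> card S \<longrightarrow> card (edges_in E S) + 3 \<le> 2 * card S)"

lemma simple_graph_finite_edges: "simple_graph V E \<Longrightarrow> finite E"
  unfolding simple_graph_def by (meson finite_imp_finite_nsets finite_subset)

lemma laman_sparse_finite:
  assumes "laman_sparse V E"
  shows "finite V" "finite E" "\<And>e. e \<in> E \<Longrightarrow> e \<subseteq> V \<and> finite e \<and> card e = 2"
  using assms simple_graph_finite_edges unfolding laman_sparse_def simple_graph_def nsets_def by auto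

lemma laman_sparse_bound:
  "laman_sparse V E \<Longrightarrow> S \<subseteq> V \<Longrightarrow> 2 \<le> card S \<Longrightarrow> card (edges_in E S) + 3 \<le> 2 * card S"
  by (simp add: laman_sparse_def)

lemma laman_graph_imp_sparse:
  assumes "laman_graph V E"
  shows "laman_sparse V E"
  unfolding laman_sparse_def
proof (intro conjI allI impI)
  show sg: "simple_graph V E" using assms by (simp add: laman_graph_def)
  fix S assume S: "S \<subseteq> V" "2 \<le> card S"
  have "simple_graph S (edges_in E S)"
    using sg S(1) by (auto simp: simple_graph_def edges_in_def nsets_def intro: finite_subset)
  then have "int (card (edges_in E S)) \<le> 2 * int (card S) - 3"
    using assms S unfolding laman_graph_def by (metis (no_types, lifting) edges_in_def mem_Collect_eq subsetI)
  then show "card (edges_in E S) + 3 \<le> 2 * card S" by linarith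
qed

lemma laman_sparse_subgraph:
  assumes "laman_sparse V E" "V' \<subseteq> V" "E' \<subseteq> E" "\<And>e. e \<in> E' \<Longrightarrow> e \<subseteq> V'"
  shows "laman_sparse V' E'"
  unfolding laman_sparse_def simple_graph_def
proof (intro conjI allI impI)
  note fin = laman_sparse_finite[OF assms(1)]
  show "finite V'" using fin(1) assms(2) by (rule rev_finite_subset)
  show "E' \<subseteq> [V']\<^bsup>2\<^esup>" using fin(3) assms(3,4) unfolding nsets_def by blast
  fix S assume S: "S \<subseteq> V'" "2 \<le> card S"
  have "card (edges_in E' S) \<le> card (edges_in E S)"
    using assms(3) fin(2) by (intro card_mono) (auto simp: edges_in_def)
  then show "card (edges_in E' S) + 3 \<le> 2 * card S"
    using laman_sparse_bound[OF assms(1) order_trans[OF S(1) assms(2)] S(2)] by linarith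
qed

text \<open>With two or more vertices the count for \<open>V\<close> itself applies; with fewer
  there are no edges.\<close>

lemma laman_sparse_card_edges:
  assumes "laman_sparse V E"
  shows "card E \<le> 2 * card V" and "V \<noteq> {} \<Longrightarrow> card E < 2 * card V"
proof -
  note fin = laman_sparse_finite[OF assms]
  have "card E = 0 \<or> card E + 3 \<le> 2 * card V"
  proof (cases "2 \<le> card V")
    case True
    have "edges_in E V = E" using fin(3) by (auto simp: edges_in_def)
    then show ?thesis using laman_sparse_bound[OF assms order_refl True] by simp
  next
    case False
    then have "E = {}" using fin card_mono by (metis ex_in_conv)
    then show ?thesis by simp
  qed
  then show "card E \<le> 2 * card V" and "V \<noteq> {} \<Longrightarrow> card E < 2 * card V"
    using fin(1) by (auto simp: card_gt_0_iff)
qed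

text \<open>The degrees sum to \<open>2 * card E < 4 * card V\<close>, so some degree is below
  four.\<close>

lemma laman_sparse_low_degree:
  assumes "laman_sparse V E" "V \<noteq> {}"
  obtains v where "v \<in> V" "card {e \<in> E. v \<in> e} \<le> 3"
proof -
  note fin = laman_sparse_finite[OF assms(1)]
  have "(\<Sum>v\<in>V. card {e \<in> E. v \<in> e}) = (\<Sum>v\<in>V. \<Sum>e\<in>E. if v \<in> e then 1 else 0)"
    using fin(2) by (intro sum.cong) (auto simp: sum.If_cases Int_def)
  also have "\<dots> = (\<Sum>e\<in>E. \<Sum>v\<in>V. if v \<in> e then 1 else 0)" by (rule sum.swap)
  also have "\<dots> = (\<Sum>e\<in>E. 2)"
  proof (rule sum.cong)
    fix e assume "e \<in> E"
    then have "V \<inter> {v. v \<in> e} = e" "card e = 2" using fin(3) by auto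
    then show "(\<Sum>v\<in>V. if v \<in> e then 1 else 0) = (2::nat)" using fin(1) by (simp add: sum.If_cases)
  qed simp
  finally have deg: "(\<Sum>v\<in>V. card {e \<in> E. v \<in> e}) < 4 * card V"
    using laman_sparse_card_edges(2)[OF assms] by simp
  have "\<exists>v\<in>V. card {e \<in> E. v \<in> e} < 4"
  proof (rule ccontr)
    assume "\<not> ?thesis"
    then have "(\<Sum>v\<in>V. 4) \<le> (\<Sum>v\<in>V. card {e \<in> E. v \<in> e})" by (intro sum_mono) (auto simp: not_less)
    then show False using deg by simp
  qed
  then show thesis using that by fastforce
qed

lemma card_edges_at:
  assumes "laman_sparse V E"
  shows "card {e \<in> E. v \<in> e} = card {a. {v, a} \<in> E}"
    and "{a. {v, a} \<in> E} \<subseteq> V - {v}"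
    and "card E = card {e \<in> E. v \<notin> e} + card {a. {v, a} \<in> E}"
proof -
  note fin = laman_sparse_finite[OF assms]
  have eq: "{e \<in> E. v \<in> e} = (\<lambda>a. {v, a}) ` {a. {v, a} \<in> E}"
  proof (rule set_eqI, rule iffI)
    fix e assume e: "e \<in> {e \<in> E. v \<in> e}"
    then have "card e = 2" using fin(3) by blast
    then obtain x y where "e = {x, y}" by (auto simp: card_2_iff)
    then have "\<exists>a. e = {v, a}" using e by auto
    then show "e \<in> (\<lambda>a. {v, a}) ` {a. {v, a} \<in> E}" using e by auto
  qed auto
  show 1: "card {e \<in> E. v \<in> e} = card {a. {v, a} \<in> E}"
    unfolding eq by (rule card_image) (auto simp: inj_on_def doubleton_eq_iff)
  show "{a. {v, a} \<in> E} \<subseteq> V - {v}"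
    using fin(3) by fastforce
  have "card E = card ({e \<in> E. v \<notin> e} \<union> {e \<in> E. v \<in> e})" by (rule arg_cong[of _ _ card]) auto
  also have "\<dots> = card {e \<in> E. v \<notin> e} + card {e \<in> E. v \<in> e}"
    using fin(2) by (intro card_Un_disjoint) auto
  finally show "card E = card {e \<in> E. v \<notin> e} + card {a. {v, a} \<in> E}" unfolding 1 .
qed

section \<open>Tight sets and Henneberg's argument\<close>

text \<open>Tight means attaining the bound \<open>2 * card S - 3\<close>. The number of induced
  edges is supermodular, and the intersection, having two vertices, obeys the bound.\<close>

lemma tight_Un:
  assumes "laman_sparse V E" "A \<subseteq> V" "B \<subseteq> V" "2 \<le> card (A \<inter> B)"
    and "2 * card A \<le> card (edges_in E A) + 3" "2 * card B \<le> card (edges_in E B) + 3"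
  shows "2 * card (A \<union> B) \<le> card (edges_in E (A \<union> B)) + 3"
proof -
  note fin = laman_sparse_finite[OF assms(1)]
  have finE: "finite (edges_in E S)" for S using fin(2) by (simp add: edges_in_def)
  have "card (edges_in E A) + card (edges_in E B)
      = card (edges_in E A \<union> edges_in E B) + card (edges_in E A \<inter> edges_in E B)"
    by (rule card_Un_Int[OF finE finE])
  also have "\<dots> \<le> card (edges_in E (A \<union> B)) + card (edges_in E (A \<inter> B))"
    by (intro add_mono card_mono finE) (auto simp: edges_in_def)
  finally have "card (edges_in E A) + card (edges_in E B)
      \<le> card (edges_in E (A \<union> B)) + card (edges_in E (A \<inter> B))" .
  moreover have "card (edges_in E (A \<inter> B)) + 3 \<le> 2 * card (A \<inter> B)"
    using assms(1-4) by (intro laman_sparse_bound) auto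
  moreover have "card A + card B = card (A \<union> B) + card (A \<inter> B)"
    by (rule card_Un_Int) (use assms(2,3) fin(1) finite_subset in auto)
  ultimately show ?thesis using assms(5,6) by linarith
qed

text \<open>Single common vertices force disjoint edge sets. The three deficits of 3 add up to 9, of
  which the three shared vertices absorb 6.\<close>

lemma tight_triangle:
  assumes "laman_sparse V E" "A \<subseteq> V" "B \<subseteq> V" "C \<subseteq> V"
    and int: "A \<inter> B = {j}" "B \<inter> C = {k}" "A \<inter> C = {i}" and ne: "i \<noteq> k"
    and "2 * card A \<le> card (edges_in E A) + 3" "2 * card B \<le> card (edges_in E B) + 3"
      "2 * card C \<le> card (edges_in E C) + 3"
  shows "2 * card (A \<union> B \<union> C) \<le> card (edges_in E (A \<union> B \<union> C)) + 3"
proof -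
  note fin = laman_sparse_finite[OF assms(1)]
  have finE: "finite (edges_in E S)" for S using fin(2) by (simp add: edges_in_def)
  have finV: "finite A" "finite B" "finite C" using assms(2-4) fin(1) by (auto intro: finite_subset)
  have disj: "edges_in E S \<inter> edges_in E T = {}" if "S \<inter> T = {x}" for S T x
  proof (rule ccontr)
    assume "edges_in E S \<inter> edges_in E T \<noteq> {}"
    then obtain e where "e \<in> E" "e \<subseteq> S \<inter> T" by (auto simp: edges_in_def)
    then have "e \<in> E" "e \<subseteq> {x}" unfolding that by auto
    then show False using fin(3)[of e] card_mono[of "{x}" e] by auto
  qed
  have "card (edges_in E A) + card (edges_in E B) + card (edges_in E C)
      = card (edges_in E A \<union> edges_in E B \<union> edges_in E C)"
    using disj[OF int(1)] disj[OF int(2)] disj[OF int(3)] finE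
    by (subst card_Un_disjoint, auto)+
  also have "\<dots> \<le> card (edges_in E (A \<union> B \<union> C))"
    by (intro card_mono finE) (auto simp: edges_in_def)
  finally have edges: "card (edges_in E A) + card (edges_in E B) + card (edges_in E C)
      \<le> card (edges_in E (A \<union> B \<union> C))" .
  have "card A + card B = card (A \<union> B) + 1"
    using card_Un_Int[OF finV(1,2)] int(1) by simp
  moreover have "(A \<union> B) \<inter> C = {i, k}" using int by auto
  then have "card (A \<union> B) + card C = card (A \<union> B \<union> C) + 2"
    using card_Un_Int[of "A \<union> B" C] finV ne by simp
  ultimately show ?thesis using edges assms(9-11) by linarith
qed

text \<open>An existing edge makes \<open>{i, j}\<close> tight, as 1 = 2 * 2 - 3. A new edge can
  break the count only on a set that contains both ends and was tight before.\<close>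

lemma blocked_pair:
  assumes "laman_sparse V E" "i \<in> V" "j \<in> V" "i \<noteq> j"
    and "\<not> ({i, j} \<notin> E \<and> laman_sparse V (insert {i, j} E))"
  obtains S where "S \<subseteq> V" "i \<in> S" "j \<in> S" "2 * card S \<le> card (edges_in E S) + 3"
proof (cases "{i, j} \<in> E")
  case True
  then have "edges_in E {i, j} \<noteq> {}" "finite (edges_in E {i, j})"
    using laman_sparse_finite(2)[OF assms(1)] by (auto simp: edges_in_def)
  then have "card (edges_in E {i, j}) \<ge> 1" by (simp add: Suc_le_eq card_gt_0_iff)
  then show thesis using that[of "{i, j}"] assms(2-4) by simp
next
  case False
  note fin = laman_sparse_finite[OF assms(1)]
  have "simple_graph V (insert {i, j} E)"
    using assms(1-4) by (auto simp: laman_sparse_def simple_graph_def nsets_def)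
  then obtain S where S: "S \<subseteq> V" "2 \<le> card S" "\<not> card (edges_in (insert {i, j} E) S) + 3 \<le> 2 * card S"
    using assms(5) False unfolding laman_sparse_def by blast
  have ij: "{i, j} \<subseteq> S"
  proof (rule ccontr)
    assume "\<not> ?thesis"
    then have "edges_in (insert {i, j} E) S = edges_in E S" by (auto simp: edges_in_def)
    then show False using S laman_sparse_bound[OF assms(1) S(1,2)] by simp
  qed
  then have "edges_in (insert {i, j} E) S = insert {i, j} (edges_in E S)" by (auto simp: edges_in_def)
  then have "card (edges_in (insert {i, j} E) S) \<le> Suc (card (edges_in E S))"
    using fin(2) by (simp add: edges_in_def card_insert_if)
  then show thesis using that[of S] S ij by auto
qed

text \<open>Suppose each pair of neighbours is blocked by a tight set avoiding \<open>v\<close>. Two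
  such sets with two common vertices have a tight union; otherwise the three form a triangle. Either
  way some tight set contains all three neighbours, and adding \<open>v\<close> to it exceeds the
  count by one.\<close>

lemma henneberg_pair:
  assumes sp: "laman_sparse V E" and v: "v \<in> V" and N: "card {a. {v, a} \<in> E} = 3"
  shows "\<exists>i j k. {a. {v, a} \<in> E} = {i, j, k} \<and> i \<noteq> j \<and> i \<noteq> k \<and> j \<noteq> k \<and>
    {i, j} \<notin> E \<and> laman_sparse (V - {v}) (insert {i, j} {e \<in> E. v \<notin> e})"
proof (rule ccontr)
  assume no: "\<not> ?thesis"
  let ?E = "{e \<in> E. v \<notin> e}"
  note fin = laman_sparse_finite[OF sp]
  have sp': "laman_sparse (V - {v}) ?E"
    by (rule laman_sparse_subgraph[OF sp]) (use fin in auto)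
  obtain a b c where abc: "{a. {v, a} \<in> E} = {a, b, c}" and ne: "a \<noteq> b" "b \<noteq> c" "a \<noteq> c"
    using N by (auto simp: card_3_iff)
  have mem: "a \<in> V - {v}" "b \<in> V - {v}" "c \<in> V - {v}"
    using card_edges_at(2)[OF sp, of v] abc by auto
  \<comment> \<open>Passing from \<open>T\<close> to \<open>insert v T\<close> adds three edges but
    raises the allowed number only by two.\<close>
  have notight: "2 * card T > card (edges_in ?E T) + 3" if T: "T \<subseteq> V - {v}" "{a, b, c} \<subseteq> T" for T
  proof -
    have finT: "finite T" using T fin(1) finite_subset by blast
    have "card {{v, a}, {v, b}, {v, c}} = 3" using ne by (auto simp: doubleton_eq_iff)
    moreover have "card (edges_in ?E T \<union> {{v, a}, {v, b}, {v, c}})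
        = card (edges_in ?E T) + card {{v, a}, {v, b}, {v, c}}"
      using fin(2) by (intro card_Un_disjoint) (auto simp: edges_in_def)
    moreover have "card (edges_in ?E T \<union> {{v, a}, {v, b}, {v, c}}) \<le> card (edges_in E (insert v T))"
      using fin(2) abc T by (intro card_mono) (auto simp: edges_in_def)
    moreover have "card (edges_in E (insert v T)) + 3 \<le> 2 * card (insert v T)"
    proof (rule laman_sparse_bound[OF sp])
      show "insert v T \<subseteq> V" using T v by auto
      have "card {a, v} \<le> card (insert v T)" using T finT by (intro card_mono) auto
      then show "2 \<le> card (insert v T)" using mem by simp
    qed
    moreover have "card (insert v T) = Suc (card T)" using T finT by (subst card_insert_disjoint) auto
    ultimately show ?thesis by linarith
  qed
  have blk: "\<exists>S \<subseteq> V - {v}. i \<in> S \<and> j \<in> S \<and> 2 * card S \<le> card (edges_in ?E S) + 3"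
    if "{i, j, k} = {a, b, c}" "i \<noteq> j" "i \<noteq> k" "j \<noteq> k" for i j k
  proof -
    have "i \<in> {a, b, c}" "j \<in> {a, b, c}" unfolding that(1)[symmetric] by simp_all
    then have ij: "i \<in> V - {v}" "j \<in> V - {v}" using mem by blast+
    have "\<not> ({i, j} \<notin> ?E \<and> laman_sparse (V - {v}) (insert {i, j} ?E))"
    proof
      assume "{i, j} \<notin> ?E \<and> laman_sparse (V - {v}) (insert {i, j} ?E)"
      moreover from this have "{i, j} \<notin> E" using ij by auto
      moreover have "{a. {v, a} \<in> E} = {i, j, k}" unfolding abc that(1) ..
      ultimately show False using no that(2-4) by blast
    qed
    then show ?thesis by (rule blocked_pair[OF sp' ij that(2)]) blast
  qed
  obtain A where A: "A \<subseteq> V - {v}" "a \<in> A" "b \<in> A" "2 * card A \<le> card (edges_in ?E A) + 3"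
    using blk[of a b c] ne by auto
  obtain B where B: "B \<subseteq> V - {v}" "b \<in> B" "c \<in> B" "2 * card B \<le> card (edges_in ?E B) + 3"
    using blk[of b c a] ne by auto
  obtain C where C: "C \<subseteq> V - {v}" "a \<in> C" "c \<in> C" "2 * card C \<le> card (edges_in ?E C) + 3"
    using blk[of a c b] ne by auto
  \<comment> \<open>Two blocking sets cover all neighbours, so a second common vertex would give a
    union excluded by \<open>notight\<close>.\<close>
  have single: "S \<inter> T = {x}"
    if st: "S \<subseteq> V - {v}" "T \<subseteq> V - {v}" "x \<in> S" "x \<in> T" "{a, b, c} \<subseteq> S \<union> T"
      "2 * card S \<le> card (edges_in ?E S) + 3" "2 * card T \<le> card (edges_in ?E T) + 3" for S T x
  proof (rule ccontr)
    assume "S \<inter> T \<noteq> {x}"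
    then obtain y where y: "y \<in> S \<inter> T" "y \<noteq> x" using st(3,4) by blast
    have "finite (S \<inter> T)" using st(1) fin(1) finite_subset by blast
    then have "card {x, y} \<le> card (S \<inter> T)" using y st by (intro card_mono) auto
    then have "2 \<le> card (S \<inter> T)" using y(2) by simp
    from tight_Un[OF sp' st(1,2) this st(6,7)] notight[of "S \<union> T"] st show False by auto
  qed
  have ABC: "A \<inter> B = {b}" "B \<inter> C = {c}" "A \<inter> C = {a}"
    using single[OF A(1) B(1) A(3) B(2) _ A(4) B(4)] single[OF B(1) C(1) B(3) C(3) _ B(4) C(4)]
      single[OF A(1) C(1) A(2) C(2) _ A(4) C(4)] A(2,3) B(2,3) C(2,3) by simp_all
  have "2 * card (A \<union> B \<union> C) \<le> card (edges_in ?E (A \<union> B \<union> C)) + 3"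
    by (rule tight_triangle[OF sp' A(1) B(1) C(1) ABC ne(3) A(4) B(4) C(4)])
  then show False using notight[of "A \<union> B \<union> C"] A B C by auto
qed

section \<open>Realizations and their coordinates\<close>

definition coord_funs :: "'i set \<Rightarrow> (('i \<Rightarrow> complex) \<Rightarrow> complex) set" where
  "coord_funs I = (\<lambda>i x. x i) ` I"

definition det_form :: "('v \<times> nat \<Rightarrow> complex) \<Rightarrow> 'v \<Rightarrow> 'v \<Rightarrow> complex" where
  "det_form x i j = (x (i, 1) - x (j, 1)) * (x (i, 4) - x (j, 4))
    - (x (i, 2) - x (j, 2)) * (x (i, 3) - x (j, 3))"

definition separated :: "('v \<times> nat \<Rightarrow> complex) \<Rightarrow> 'v \<Rightarrow> 'v \<Rightarrow> bool" where
  "separated x i j \<longleftrightarrow> x (i, 1) \<noteq> x (j, 1) \<or> x (i, 2) \<noteq> x (j, 2) \<or> x (i, 3) \<noteq> x (j, 3)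
    \<or> x (i, 4) \<noteq> x (j, 4)"

text \<open>Points are plain functions, not extensional ones, so that a realization of a graph is
  literally a realization of each subgraph.\<close>

definition realizations :: "'v set \<Rightarrow> 'v set set \<Rightarrow> ('v \<times> nat \<Rightarrow> complex) set" where
  "realizations V E = {x. (\<forall>i\<in>V. \<forall>j\<in>V. i \<noteq> j \<longrightarrow> separated x i j) \<and>
    (\<forall>i j. {i, j} \<in> E \<longrightarrow> det_form x i j = 0)}"

lemma det_form_commute: "det_form x i j = det_form x j i"
  unfolding det_form_def by algebra

lemma coord_palg: "p \<in> I \<Longrightarrow> (\<lambda>x. x p) \<in> palg (coord_funs I)"
  by (rule palg_gen) (auto simp: coord_funs_def)

text \<open>The fibre lemmas place \<open>v\<close> relative to a neighbour \<open>a\<close>. Adding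
  back the coordinates of \<open>a\<close>, which are generators already, recovers those of
  \<open>v\<close>.\<close>

lemma growth_le_add_vertex:
  assumes "growth_le ({\<lambda>x. x (v, 1) - x (a, 1), \<lambda>x. x (v, 2) - x (a, 2), \<lambda>x. x (v, 3) - x (a, 3),
      \<lambda>x. x (v, 4) - x (a, 4)} \<union> coord_funs (V \<times> {1..4::nat})) S k"
    and "a \<in> V" "finite V"
  shows "growth_le (coord_funs (insert v V \<times> {1..4})) S k"
  using assms(1)
proof (rule growth_le_subst)
  let ?G = "{\<lambda>x. x (v, 1) - x (a, 1), \<lambda>x. x (v, 2) - x (a, 2), \<lambda>x. x (v, 3) - x (a, 3),
      \<lambda>x. x (v, 4) - x (a, 4)} \<union> coord_funs (V \<times> {1..4::nat})"
  show "finite (coord_funs (insert v V \<times> {1..4::nat}))" using assms(3) by (simp add: coord_funs_def)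
  fix f :: "('a \<times> nat \<Rightarrow> complex) \<Rightarrow> complex"
  assume "f \<in> coord_funs (insert v V \<times> {1..4})"
  then obtain i l where f: "f = (\<lambda>x. x (i, l))" "i = v \<or> i \<in> V" "l \<in> {1..4}"
    by (auto simp: coord_funs_def)
  show "f \<in> palg ?G"
  proof (cases "i \<in> V")
    case True
    then show ?thesis using f by (intro palg_gen) (auto simp: coord_funs_def)
  next
    case False
    have "l \<in> {1, 2, 3, 4}" using f(3) by auto
    then have "(\<lambda>x. x (v, l) - x (a, l)) \<in> ?G" by auto
    moreover have "(\<lambda>x. x (a, l)) \<in> ?G" using assms(2) f(3) by (auto simp: coord_funs_def)
    ultimately have "(\<lambda>x. (x (v, l) - x (a, l)) + x (a, l)) \<in> palg ?G"
      by (intro palg_add palg_gen)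
    then show ?thesis using False f by simp
  qed
qed

lemma growth_le_vertex0:
  assumes "growth_le (coord_funs (V \<times> {1..4::nat})) S k"
  shows "growth_le (coord_funs (insert v V \<times> {1..4})) S (k + 4)"
  using growth_le_fibre0[OF assms, of "\<lambda>x. x (v, 1)" "\<lambda>x. x (v, 2)" "\<lambda>x. x (v, 3)" "\<lambda>x. x (v, 4)"]
proof (rule growth_le_mono)
  have "{1..4::nat} = {1, 2, 3, 4}" by auto
  then show "coord_funs (insert v V \<times> {1..4::nat}) \<subseteq> {\<lambda>x. x (v, 1), \<lambda>x. x (v, 2), \<lambda>x. x (v, 3),
      \<lambda>x. x (v, 4)} \<union> coord_funs (V \<times> {1..4})"
    by (auto simp: coord_funs_def)
qed auto

lemma growth_le_vertex1:
  assumes "growth_le (coord_funs (V \<times> {1..4::nat})) S k" "finite V" "a \<in> V"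
    and "\<And>x. x \<in> S \<Longrightarrow> det_form x v a = 0"
  shows "growth_le (coord_funs (insert v V \<times> {1..4})) S (k + 3)"
  using assms(4) by (intro growth_le_add_vertex[OF growth_le_fibre1[OF assms(1)] assms(3,2)])
    (simp add: det_form_def)

text \<open>With \<open>a\<close> as origin and \<open>w\<close> the position of \<open>b\<close>,
  subtracting the form at \<open>u\<close> from the form at \<open>u - w\<close> leaves a linear
  equation with constant term \<open>det_form x b a\<close>.\<close>

lemma growth_le_vertex2:
  assumes "growth_le (coord_funs (V \<times> {1..4::nat})) S k" "finite V" "a \<in> V" "b \<in> V"
    and q: "\<And>x. x \<in> S \<Longrightarrow> det_form x v a = 0" "\<And>x. x \<in> S \<Longrightarrow> det_form x v b = 0"
    and sep: "\<And>x. x \<in> S \<Longrightarrow> separated x a b"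
  shows "growth_le (coord_funs (insert v V \<times> {1..4})) S (k + 2)"
proof (rule growth_le_add_vertex[OF growth_le_fibre2[OF assms(1), of
    "\<lambda>x. x (b, 1) - x (a, 1)" "\<lambda>x. x (b, 2) - x (a, 2)" "\<lambda>x. x (b, 3) - x (a, 3)"
    "\<lambda>x. x (b, 4) - x (a, 4)" "\<lambda>x. det_form x b a"] assms(3,2)])
  fix x assume x: "x \<in> S"
  show "(x (v, 1) - x (a, 1)) * (x (v, 4) - x (a, 4)) = (x (v, 2) - x (a, 2)) * (x (v, 3) - x (a, 3))"
    using q(1)[OF x] by (simp add: det_form_def)
  show "(x (v, 1) - x (a, 1)) * (x (b, 4) - x (a, 4)) + (x (v, 4) - x (a, 4)) * (x (b, 1) - x (a, 1))
    = (x (v, 2) - x (a, 2)) * (x (b, 3) - x (a, 3)) + (x (v, 3) - x (a, 3)) * (x (b, 2) - x (a, 2))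
      + det_form x b a"
    using q(1)[OF x] q(2)[OF x] unfolding det_form_def by algebra
  show "x (b, 1) - x (a, 1) \<noteq> 0 \<or> x (b, 2) - x (a, 2) \<noteq> 0 \<or> x (b, 3) - x (a, 3) \<noteq> 0
      \<or> x (b, 4) - x (a, 4) \<noteq> 0"
    using sep[OF x] by (auto simp: separated_def)
qed (use assms(3,4) in \<open>auto simp: det_form_def intro!: palg_diff palg_mult coord_palg\<close>)

text \<open>With \<open>a\<close> as origin, \<open>b\<close> yields \<open>w\<close> and
  \<open>c\<close> yields \<open>v\<close> in \<open>growth_le_fibre3\<close>. Skewness of
  \<open>a\<close>, \<open>b\<close> makes \<open>w\<close> non-isotropic, and separation from
  \<open>c\<close> says that \<open>v\<close> is neither 0 nor \<open>w\<close>.\<close>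

lemma growth_le_vertex3:
  assumes "growth_le (coord_funs (V \<times> {1..4::nat})) S k" "finite V" "a \<in> V" "b \<in> V" "c \<in> V"
    and q: "\<And>x. x \<in> S \<Longrightarrow> det_form x v a = 0" "\<And>x. x \<in> S \<Longrightarrow> det_form x v b = 0"
      "\<And>x. x \<in> S \<Longrightarrow> det_form x v c = 0"
    and sep: "\<And>x. x \<in> S \<Longrightarrow> separated x a c" "\<And>x. x \<in> S \<Longrightarrow> separated x b c"
    and skew: "\<And>x. x \<in> S \<Longrightarrow> det_form x a b \<noteq> 0"
  shows "growth_le (coord_funs (insert v V \<times> {1..4})) S (k + 1)"
proof (rule growth_le_add_vertex[OF growth_le_fibre3[OF assms(1), of
    "\<lambda>x. x (b, 1) - x (a, 1)" "\<lambda>x. x (b, 2) - x (a, 2)" "\<lambda>x. x (b, 3) - x (a, 3)"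
    "\<lambda>x. x (b, 4) - x (a, 4)" "\<lambda>x. x (c, 1) - x (a, 1)" "\<lambda>x. x (c, 2) - x (a, 2)"
    "\<lambda>x. x (c, 3) - x (a, 3)" "\<lambda>x. x (c, 4) - x (a, 4)"] assms(3,2)])
  fix x assume x: "x \<in> S"
  note qx = q[OF x, unfolded det_form_def]
  show "(x (v, 1) - x (a, 1)) * (x (v, 4) - x (a, 4)) = (x (v, 2) - x (a, 2)) * (x (v, 3) - x (a, 3))"
    using qx(1) by simp
  show "(x (v, 1) - x (a, 1)) * (x (b, 4) - x (a, 4)) + (x (v, 4) - x (a, 4)) * (x (b, 1) - x (a, 1))
    = (x (v, 2) - x (a, 2)) * (x (b, 3) - x (a, 3)) + (x (v, 3) - x (a, 3)) * (x (b, 2) - x (a, 2))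
      + ((x (b, 1) - x (a, 1)) * (x (b, 4) - x (a, 4)) - (x (b, 2) - x (a, 2)) * (x (b, 3) - x (a, 3)))"
    using qx(1,2) by algebra
  show "(x (v, 1) - x (a, 1)) * (x (c, 4) - x (a, 4)) + (x (v, 4) - x (a, 4)) * (x (c, 1) - x (a, 1))
    = (x (v, 2) - x (a, 2)) * (x (c, 3) - x (a, 3)) + (x (v, 3) - x (a, 3)) * (x (c, 2) - x (a, 2))
      + ((x (c, 1) - x (a, 1)) * (x (c, 4) - x (a, 4)) - (x (c, 2) - x (a, 2)) * (x (c, 3) - x (a, 3)))"
    using qx(1,3) by algebra
  show "(x (b, 1) - x (a, 1)) * (x (b, 4) - x (a, 4)) - (x (b, 2) - x (a, 2)) * (x (b, 3) - x (a, 3)) \<noteq> 0"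
    using skew[OF x] unfolding det_form_commute[of x a b] by (simp add: det_form_def)
  show "x (c, 1) - x (a, 1) \<noteq> 0 \<or> x (c, 2) - x (a, 2) \<noteq> 0 \<or> x (c, 3) - x (a, 3) \<noteq> 0
      \<or> x (c, 4) - x (a, 4) \<noteq> 0"
    using sep(1)[OF x] by (auto simp: separated_def)
  show "x (c, 1) - x (a, 1) \<noteq> x (b, 1) - x (a, 1) \<or> x (c, 2) - x (a, 2) \<noteq> x (b, 2) - x (a, 2)
      \<or> x (c, 3) - x (a, 3) \<noteq> x (b, 3) - x (a, 3) \<or> x (c, 4) - x (a, 4) \<noteq> x (b, 4) - x (a, 4)"
    using sep(2)[OF x] by (auto simp: separated_def)
qed (use assms(3-5) in \<open>auto intro!: palg_diff coord_palg\<close>)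

theorem growth_le_realizations:
  assumes "laman_sparse V E"
  shows "growth_le (coord_funs (V \<times> {1..4})) (realizations V E) (4 * card V - card E)"
  using assms
proof (induction "card V" arbitrary: V E)
  case 0
  then have "V = {}" using laman_sparse_finite(1)[OF 0(2)] by simp
  then show ?case using growth_le_no_gens by (simp add: coord_funs_def)
next
  case (Suc n)
  note sp = Suc.prems
  note fin = laman_sparse_finite[OF sp]
  have "V \<noteq> {}" using Suc(2) by auto
  then obtain v where v: "v \<in> V" and deg: "card {e \<in> E. v \<in> e} \<le> 3"
    using laman_sparse_low_degree[OF sp] by blast
  let ?V = "V - {v}" and ?E = "{e \<in> E. v \<notin> e}" and ?N = "{a. {v, a} \<in> E}" and ?S = "realizations V E"
  have n: "card ?V = n" using Suc(2) v fin(1) by simp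
  have finV: "finite ?V" using fin(1) by simp
  have insV: "insert v ?V = V" using v by auto
  note N = card_edges_at[OF sp, of v]
  have finN: "finite ?N" using N(2) finV by (rule finite_subset)
  have sp': "laman_sparse ?V ?E" by (rule laman_sparse_subgraph[OF sp]) (use fin in auto)
  \<comment> \<open>This keeps the subtractions in the exponents from being truncated.\<close>
  have card: "card ?E \<le> 2 * n" using laman_sparse_card_edges(1)[OF sp'] n by simp
  have dim: "4 * n - card ?E + (4 - card ?N) = 4 * card V - card E"
    using N(1,3) deg card Suc(2) by simp
  have IH: "growth_le (coord_funs (?V \<times> {1..4})) S (4 * n - card ?E)" if "S \<subseteq> ?S" for S
    using Suc(1)[OF n[symmetric] sp'] unfolding n
    by (rule growth_le_mono) (use that in \<open>auto simp: realizations_def\<close>)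
  have qN: "det_form x v a = 0" if "x \<in> ?S" "a \<in> ?N" for x a
    using that by (auto simp: realizations_def)
  have sep: "separated x a b" if "x \<in> ?S" "a \<in> ?N" "b \<in> ?N" "a \<noteq> b" for x a b
  proof -
    have "a \<in> V" "b \<in> V" using N(2) that(2,3) by blast+
    then show ?thesis using that(1,4) by (auto simp: realizations_def)
  qed
  have "card ?N = 0 \<or> card ?N = 1 \<or> card ?N = 2 \<or> card ?N = 3" using N(1) deg by linarith
  then consider "card ?N = 0" | "card ?N = 1" | "card ?N = 2" | "card ?N = 3" by (elim disjE) simp_all
  then show ?case
  proof cases
    case 1
    from growth_le_vertex0[OF IH[OF order_refl], of v] show ?thesis using dim 1 insV by simp
  next
    case 2
    then obtain a where a: "?N = {a}" by (auto simp: card_1_singleton_iff)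
    have "a \<in> ?V" using a N(2) by auto
    from growth_le_vertex1[OF IH[OF order_refl] finV this, of v] show ?thesis
      using dim 2 insV qN a by auto
  next
    case 3
    then obtain a b where ab: "?N = {a, b}" "a \<noteq> b" by (auto simp: card_2_iff)
    have "a \<in> ?V" "b \<in> ?V" using ab N(2) by auto
    from growth_le_vertex2[OF IH[OF order_refl] finV this, of v] show ?thesis
      using dim 3 insV qN sep ab by auto
  next
    case 4
    obtain i j k where ijk: "?N = {i, j, k}" "i \<noteq> j" "i \<noteq> k" "j \<noteq> k"
      and ij: "{i, j} \<notin> E" "laman_sparse ?V (insert {i, j} ?E)"
      using henneberg_pair[OF sp v 4] by blast
    have mem: "i \<in> ?V" "j \<in> ?V" "k \<in> ?V" using ijk N(2) by auto
    \<comment> \<open>The chosen neighbours either meet, so that the added edge is realized as well,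
      or are skew.\<close>
    let ?A = "{x \<in> ?S. det_form x i j = 0}" and ?B = "{x \<in> ?S. \<not> det_form x i j = 0}"
    have "growth_le (coord_funs (?V \<times> {1..4})) ?A (4 * n - card (insert {i, j} ?E))"
      using Suc(1)[OF n[symmetric] ij(2)] unfolding n
      by (rule growth_le_mono)
         (auto simp: realizations_def doubleton_eq_iff det_form_commute)
    \<comment> \<open>The conditions at \<open>i\<close> and \<open>j\<close> alone allow the fibre
      two dimensions; the added edge makes up for this by lowering the exponent of the base by
      one.\<close>
    from growth_le_vertex2[OF this finV mem(1,2), of v]
    have A: "growth_le (coord_funs (V \<times> {1..4})) ?A (4 * n - card (insert {i, j} ?E) + 2)"
      using qN sep ijk insV by auto
    have "card (insert {i, j} ?E) = Suc (card ?E)" using ij(1) fin(2) by simp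
    moreover have "card (insert {i, j} ?E) \<le> 2 * n" using laman_sparse_card_edges(1)[OF ij(2)] n by simp
    ultimately have "4 * n - card (insert {i, j} ?E) + 2 = 4 * card V - card E" using dim 4 by linarith
    then have A: "growth_le (coord_funs (V \<times> {1..4})) ?A (4 * card V - card E)" using A by simp
    have "growth_le (coord_funs (insert v ?V \<times> {1..4})) ?B (4 * n - card ?E + 1)"
    proof (rule growth_le_vertex3[OF IH finV mem])
      fix x assume "x \<in> ?B"
      then have x: "x \<in> ?S" and ne: "det_form x i j \<noteq> 0" by simp_all
      show "det_form x v i = 0" "det_form x v j = 0" "det_form x v k = 0"
        by (rule qN[OF x], simp add: ijk(1))+
      show "separated x i k" "separated x j k"
        by (rule sep[OF x]; simp add: ijk)+
      show "det_form x i j \<noteq> 0" by (rule ne)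
    qed auto
    then have "growth_le (coord_funs (V \<times> {1..4})) ?B (4 * card V - card E)"
      using dim unfolding 4 insV by simp
    with A show ?thesis by (rule growth_le_split)
  qed
qed

section \<open>Chains of irreducible closed sets\<close>

text \<open>Gaussian elimination: a vector \<open>b\<close> with nonzero entry in coordinate
  \<open>N\<close> clears that entry from the others, at the price of one vector and one
  coordinate.\<close>

lemma linear_dependence:
  fixes v :: "'b \<Rightarrow> nat \<Rightarrow> 'c :: field"
  assumes "finite A" "N < card A"
  shows "\<exists>c. (\<exists>a\<in>A. c a \<noteq> 0) \<and> (\<forall>i<N. (\<Sum>a\<in>A. c a * v a i) = 0)"
  using assms
proof (induction N arbitrary: A v)
  case 0
  then have "A \<noteq> {}" by auto
  then show ?case by (intro exI[of _ "\<lambda>_. 1"]) auto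
next
  case (Suc N)
  show ?case
  proof (cases "\<forall>a\<in>A. v a N = 0")
    case True
    then show ?thesis using Suc.IH[of A v] Suc.prems by (auto simp: less_Suc_eq)
  next
    case False
    then obtain b where b: "b \<in> A" "v b N \<noteq> 0" by blast
    let ?A = "A - {b}"
    have "finite ?A" "N < card ?A" using Suc.prems b by simp_all
    from Suc.IH[OF this, of "\<lambda>a i. v a i - v a N / v b N * v b i"]
    obtain c where c: "\<exists>a\<in>?A. c a \<noteq> 0"
      "\<forall>i<N. (\<Sum>a\<in>?A. c a * (v a i - v a N / v b N * v b i)) = 0" by blast
    \<comment> \<open>The coefficient of \<open>b\<close> collects all multiples of
      \<open>v b\<close> subtracted in the elimination.\<close>
    define d where "d = (\<lambda>a. if a = b then - (\<Sum>a\<in>?A. c a * v a N) / v b N else c a)"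
    have sum: "(\<Sum>a\<in>A. d a * v a i) = (\<Sum>a\<in>?A. c a * (v a i - v a N / v b N * v b i))" for i
    proof -
      have "(\<Sum>a\<in>A. d a * v a i) = d b * v b i + (\<Sum>a\<in>?A. d a * v a i)"
        using Suc.prems b by (simp add: sum.remove)
      also have "(\<Sum>a\<in>?A. d a * v a i) = (\<Sum>a\<in>?A. c a * v a i)"
        by (rule sum.cong) (auto simp: d_def)
      also have "d b * v b i = - (\<Sum>a\<in>?A. c a * (v a N / v b N * v b i))"
        by (simp add: d_def sum_divide_distrib sum_distrib_right mult.assoc)
      finally show ?thesis by (simp add: right_diff_distrib sum_subtractf)
    qed
    have "(\<Sum>a\<in>A. d a * v a i) = 0" if "i < Suc N" for i
      unfolding sum using that c(2) b(2) by (cases "i = N") auto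
    moreover have "\<exists>a\<in>A. d a \<noteq> 0" using c(1) by (auto simp: d_def)
    ultimately show ?thesis by blast
  qed
qed

lemma spanned_dependent:
  assumes "spanned S P N" "finite A" "N < card A" "\<And>a. a \<in> A \<Longrightarrow> g a \<in> P"
  shows "\<exists>c. (\<exists>a\<in>A. c a \<noteq> 0) \<and> (\<forall>x\<in>S. (\<Sum>a\<in>A. c a * g a x) = 0)"
proof -
  obtain b where "\<forall>p\<in>P. \<exists>c. \<forall>x\<in>S. p x = (\<Sum>i<N. c i * b i x)"
    using assms(1) unfolding spanned_def by blast
  then have "\<forall>a. \<exists>c. a \<in> A \<longrightarrow> (\<forall>x\<in>S. g a x = (\<Sum>i<N. c i * b i x))" using assms(4) by blast
  then obtain v where v: "\<forall>a. a \<in> A \<longrightarrow> (\<forall>x\<in>S. g a x = (\<Sum>i<N. v a i * b i x))"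
    unfolding choice_iff by blast
  obtain c where c: "\<exists>a\<in>A. c a \<noteq> 0" "\<forall>i<N. (\<Sum>a\<in>A. c a * v a i) = 0"
    using linear_dependence[OF assms(2,3)] by blast
  have "(\<Sum>a\<in>A. c a * g a x) = 0" if "x \<in> S" for x
  proof -
    have "(\<Sum>a\<in>A. c a * g a x) = (\<Sum>a\<in>A. \<Sum>i<N. c a * v a i * b i x)"
      using v that by (simp add: sum_distrib_left mult.assoc)
    also have "\<dots> = (\<Sum>i<N. (\<Sum>a\<in>A. c a * v a i) * b i x)"
      by (subst sum.swap) (simp add: sum_distrib_right)
    finally show ?thesis using c(2) by simp
  qed
  then show ?thesis using c(1) by blast
qed

section \<open>Zariski closure and irreducibility\<close>

lemma poly_funs_eq_palg: "poly_funs I = palg (coord_funs I)"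
proof (intro equalityI subsetI)
  fix p assume "p \<in> poly_funs I"
  then show "p \<in> palg (coord_funs I)"
    by induction (auto intro: palg_const palg_add palg_mult coord_palg)
next
  fix p assume "p \<in> palg (coord_funs I)"
  then obtain m where "poly_deg (coord_funs I) m p" by (auto simp: palg_def)
  then show "p \<in> poly_funs I"
    by induction (auto intro: poly_funs.intros simp: coord_funs_def)
qed

lemma palg_sum: "(\<And>a. a \<in> A \<Longrightarrow> f a \<in> palg F) \<Longrightarrow> (\<lambda>x. \<Sum>a\<in>A. f a x) \<in> palg F"
  by (induction A rule: infinite_finite_induct) (auto intro: palg_const palg_add)

text \<open>The common zeros in affine space of all polynomials vanishing on \<open>S\<close> form
  the least closed set containing \<open>S\<close>; the assumption puts \<open>S\<close> inside
  it.\<close>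

lemma mem_zariski_closure:
  assumes "S \<subseteq> affine_space I"
  shows "x \<in> zariski_closure I S \<longleftrightarrow>
    x \<in> affine_space I \<and> (\<forall>p\<in>poly_funs I. (\<forall>y\<in>S. p y = 0) \<longrightarrow> p x = 0)" (is "_ \<longleftrightarrow> ?R")
proof
  let ?P = "{p \<in> poly_funs I. \<forall>y\<in>S. p y = 0}"
  have "zariski_closed I {x \<in> affine_space I. \<forall>p\<in>?P. p x = 0}"
    unfolding zariski_closed_def by (intro exI[of _ ?P]) auto
  moreover have "S \<subseteq> {x \<in> affine_space I. \<forall>p\<in>?P. p x = 0}" using assms by auto
  moreover assume "x \<in> zariski_closure I S"
  ultimately show ?R unfolding zariski_closure_def by blast
next
  assume R: ?R
  show "x \<in> zariski_closure I S" unfolding zariski_closure_def zariski_closed_def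
    using R by blast
qed

lemma zariski_closed_zariski_closure:
  assumes "S \<subseteq> affine_space I"
  shows "zariski_closed I (zariski_closure I S)"
  unfolding zariski_closed_def
  by (intro exI[of _ "{p \<in> poly_funs I. \<forall>y\<in>S. p y = 0}"])
     (auto simp: mem_zariski_closure[OF assms])

lemma subset_zariski_closure: "S \<subseteq> zariski_closure I S"
  by (auto simp: zariski_closure_def)

lemma zariski_closure_subset: "zariski_closed I Z \<Longrightarrow> S \<subseteq> Z \<Longrightarrow> zariski_closure I S \<subseteq> Z"
  by (auto simp: zariski_closure_def)

lemma zariski_closed_vanishing:
  assumes "zariski_closed I Z" "p \<in> poly_funs I"
  shows "zariski_closed I {x \<in> Z. p x = 0}"
proof -
  obtain P where P: "P \<subseteq> poly_funs I" "Z = {x \<in> affine_space I. \<forall>p\<in>P. p x = 0}"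
    using assms(1) unfolding zariski_closed_def by blast
  then show ?thesis unfolding zariski_closed_def
    by (intro exI[of _ "insert p P"]) (use assms(2) in auto)
qed

text \<open>The zero sets of \<open>p\<close> and \<open>q\<close> in \<open>Z\<close> are closed
  and cover \<open>Z\<close>.\<close>

lemma irreducible_closed_prime:
  assumes "irreducible_closed I Z" "p \<in> poly_funs I" "q \<in> poly_funs I"
    and "\<And>x. x \<in> Z \<Longrightarrow> p x * q x = 0"
  shows "(\<forall>x\<in>Z. p x = 0) \<or> (\<forall>x\<in>Z. q x = 0)"
proof -
  have "zariski_closed I {x \<in> Z. p x = 0}" "zariski_closed I {x \<in> Z. q x = 0}"
    using assms(1-3) by (auto simp: irreducible_closed_def intro: zariski_closed_vanishing)
  moreover have "Z = {x \<in> Z. p x = 0} \<union> {x \<in> Z. q x = 0}" using assms(4) by auto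
  ultimately have "Z = {x \<in> Z. p x = 0} \<or> Z = {x \<in> Z. q x = 0}"
    using assms(1) unfolding irreducible_closed_def by blast
  then show ?thesis by blast
qed

lemma zariski_closed_separating:
  assumes "zariski_closed I Z" "zariski_closed I Z'" "Z \<subset> Z'"
  shows "\<exists>f\<in>poly_funs I. (\<forall>x\<in>Z. f x = 0) \<and> (\<exists>x\<in>Z'. f x \<noteq> 0)"
proof -
  obtain P where P: "P \<subseteq> poly_funs I" "Z = {x \<in> affine_space I. \<forall>p\<in>P. p x = 0}"
    using assms(1) unfolding zariski_closed_def by blast
  have "Z' \<subseteq> affine_space I" using assms(2) unfolding zariski_closed_def by auto
  then show ?thesis using P assms(3) by blast
qed

section \<open>Monomials along a chain\<close>

text \<open>The head of the list is the exponent of the function with the largest index, so that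
  removing it descends one step in the chain.\<close>

fun monomial :: "(nat \<Rightarrow> 'a \<Rightarrow> complex) \<Rightarrow> nat list \<Rightarrow> 'a \<Rightarrow> complex" where
  "monomial f [] = (\<lambda>_. 1)"
| "monomial f (a # as) = (\<lambda>x. f (length as) x ^ a * monomial f as x)"

text \<open>Each exponent is bounded separately, not the total degree, which makes the number of
  monomials exactly \<open>Suc m ^ k\<close>.\<close>

definition exponents :: "nat \<Rightarrow> nat \<Rightarrow> nat list set" where
  "exponents m k = {as. set as \<subseteq> {..m} \<and> length as = k}"

lemma finite_exponents: "finite (exponents m k)"
  unfolding exponents_def by (rule finite_lists_length_eq) simp

lemma card_exponents: "card (exponents m k) = Suc m ^ k"
  unfolding exponents_def by (subst card_lists_length_eq) auto

lemma sum_exponents_Suc: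
  "(\<Sum>as\<in>exponents m (Suc k). g as) = (\<Sum>a\<le>m. \<Sum>as\<in>exponents m k. g (a # as))"
proof -
  have "exponents m (Suc k) = (\<lambda>(a, as). a # as) ` ({..m} \<times> exponents m k)"
    by (auto simp: exponents_def length_Suc_conv image_iff)
  moreover have "inj_on (\<lambda>(a, as). a # as) ({..m} \<times> exponents m k)" by (auto simp: inj_on_def)
  ultimately show ?thesis by (simp add: sum.reindex sum.cartesian_product case_prod_unfold)
qed

lemma poly_deg_monomial:
  assumes "\<And>i. i < length as \<Longrightarrow> poly_deg F D (f i)" "set as \<subseteq> {..m}"
  shows "poly_deg F (length as * (m * D)) (monomial f as)"
  using assms
proof (induction as)
  case Nil
  then show ?case by (simp add: poly_deg.const)
next
  case (Cons a as)
  have "poly_deg F (a * D) (\<lambda>x. f (length as) x ^ a)" by (rule poly_deg_power) (simp add: Cons.prems)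
  moreover have "a * D \<le> m * D" using Cons.prems by simp
  ultimately have "poly_deg F (m * D) (\<lambda>x. f (length as) x ^ a)" by (rule poly_deg_le)
  moreover have "poly_deg F (length as * (m * D)) (monomial f as)" using Cons by simp
  ultimately show ?case by (simp add: poly_deg.mult)
qed

text \<open>A vanishing combination is a polynomial in \<open>f k\<close> with coefficients
  \<open>h a\<close>. Its lowest power of \<open>f k\<close> cancels on the irreducible set
  \<open>Z (Suc k)\<close>, where \<open>f k\<close> is not identically zero. On \<open>Z k\<close>
  only the lowest coefficient then remains, and the induction hypothesis applies to it.\<close>

lemma chain_monomials_independent:
  assumes "\<And>i. i \<le> k \<Longrightarrow> irreducible_closed I (Z i)"
    and "\<And>i. i < k \<Longrightarrow> Z i \<subseteq> Z (Suc i)"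
    and "\<And>i. i < k \<Longrightarrow> f i \<in> poly_funs I"
    and "\<And>i x. i < k \<Longrightarrow> x \<in> Z i \<Longrightarrow> f i x = 0"
    and "\<And>i. i < k \<Longrightarrow> \<exists>x\<in>Z (Suc i). f i x \<noteq> 0"
    and "\<And>x. x \<in> Z k \<Longrightarrow> (\<Sum>as\<in>exponents m k. c as * monomial f as x) = 0"
    and "as \<in> exponents m k"
  shows "c as = 0"
  using assms
proof (induction k arbitrary: c as)
  case 0
  then obtain x where "x \<in> Z 0" by (auto simp: irreducible_closed_def)
  moreover have "exponents m 0 = {[]}" by (auto simp: exponents_def)
  ultimately show ?case using "0.prems"(6)[of x] "0.prems"(7) by simp
next
  case (Suc k)
  define h where "h a x = (\<Sum>as\<in>exponents m k. c (a # as) * monomial f as x)" for a x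
  have IH: "c (a # as) = 0" if "\<And>x. x \<in> Z k \<Longrightarrow> h a x = 0" "as \<in> exponents m k" for a as
    by (rule Suc.IH) (use Suc.prems(1-5) that in \<open>auto simp: h_def\<close>)
  have mon: "monomial f as \<in> poly_funs I" if "length as \<le> k" for as
    using that
  proof (induction as)
    case (Cons a as)
    then have "f (length as) \<in> palg (coord_funs I)"
      using Suc.prems(3)[of "length as"] by (simp add: poly_funs_eq_palg)
    then show ?case using Cons by (auto simp: poly_funs_eq_palg intro!: palg_mult palg_power)
  qed (auto intro: poly_funs.const)
  have h: "h a \<in> poly_funs I" for a
    using mon unfolding h_def poly_funs_eq_palg exponents_def
    by (intro palg_sum palg_mult palg_const) auto
  have f: "f k \<in> poly_funs I" using Suc.prems(3) by simp
  obtain y where y: "y \<in> Z (Suc k)" "f k y \<noteq> 0" using Suc.prems(5) by blast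
  have rel: "(\<Sum>a\<le>m. f k x ^ a * h a x) = 0" if "x \<in> Z (Suc k)" for x
  proof -
    have "(\<Sum>a\<le>m. f k x ^ a * h a x) = (\<Sum>as\<in>exponents m (Suc k). c as * monomial f as x)"
      unfolding sum_exponents_Suc h_def sum_distrib_left
      by (intro sum.cong refl) (auto simp: exponents_def)
    then show ?thesis using Suc.prems(6)[OF that] by simp
  qed
  have *: "\<forall>as\<in>exponents m k. c (a # as) = 0" if "a \<le> m" for a
    using that
  proof (induction a rule: less_induct)
    case (less b)
    have h0: "h a x = 0" if "a < b" for a x
      using less that by (simp add: h_def)
    \<comment> \<open>This is the relation divided by \<open>f k x ^ b\<close>; the terms below
      \<open>b\<close> are already known to vanish.\<close>
    define r where "r x = (\<Sum>a=b..m. f k x ^ (a - b) * h a x)" for x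
    have "r \<in> poly_funs I"
      using f h unfolding r_def poly_funs_eq_palg by (intro palg_sum palg_mult palg_power)
    moreover have "(\<lambda>x. f k x ^ b) \<in> poly_funs I"
      using f unfolding poly_funs_eq_palg by (rule palg_power)
    moreover have "f k x ^ b * r x = 0" if "x \<in> Z (Suc k)" for x
    proof -
      have "f k x ^ b * r x = (\<Sum>a=b..m. f k x ^ a * h a x)"
        unfolding r_def sum_distrib_left
        by (intro sum.cong refl) (simp add: mult.assoc[symmetric] flip: power_add)
      also have "\<dots> = (\<Sum>a\<le>m. f k x ^ a * h a x)"
        by (rule sum.mono_neutral_left) (auto simp: h0)
      finally show ?thesis using rel[OF that] by simp
    qed
    ultimately have "(\<forall>x\<in>Z (Suc k). f k x ^ b = 0) \<or> (\<forall>x\<in>Z (Suc k). r x = 0)"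
      using Suc.prems(1)[of "Suc k"] by (intro irreducible_closed_prime) auto
    then have r: "r x = 0" if "x \<in> Z (Suc k)" for x using y that by auto
    have "h b x = 0" if "x \<in> Z k" for x
    proof -
      \<comment> \<open>Since \<open>f k x = 0\<close>, only the term with exponent 0 survives, as
        \<open>0 ^ 0 = 1\<close>.\<close>
      have "r x = (\<Sum>a=b..m. if a = b then h b x else 0)"
        unfolding r_def using Suc.prems(4)[of k x] that by (intro sum.cong) auto
      then have "r x = h b x" using less.prems by simp
      then show ?thesis using r[of x] Suc.prems(2)[of k] that by auto
    qed
    then show ?case using IH by blast
  qed
  obtain a bs where "as = a # bs" "a \<le> m" "bs \<in> exponents m k"
    using Suc.prems(7) by (auto simp: exponents_def length_Suc_conv)
  then show ?case using * by blast
qed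

text \<open>If \<open>K < k\<close>, then for large \<open>m\<close> the \<open>Suc m ^ k\<close>
  monomials in separating functions outnumber a spanning family for their degree. The resulting
  dependence on \<open>S\<close> persists on the closure and contradicts independence on
  \<open>Z k\<close>.\<close>

lemma growth_le_chain_length:
  assumes g: "growth_le (coord_funs I) S K" and S: "S \<subseteq> affine_space I"
    and irr: "\<And>i. i \<le> k \<Longrightarrow> irreducible_closed I (Z i)"
    and sub: "Z k \<subseteq> zariski_closure I S"
    and chain: "\<And>i. i < k \<Longrightarrow> Z i \<subset> Z (Suc i)"
  shows "k \<le> K"
proof (rule ccontr)
  assume "\<not> k \<le> K"
  have "\<exists>f\<in>poly_funs I. (\<forall>x\<in>Z i. f x = 0) \<and> (\<exists>x\<in>Z (Suc i). f x \<noteq> 0)" if "i < k" for i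
    using that irr[of i] irr[of "Suc i"] chain
    by (intro zariski_closed_separating) (auto simp: irreducible_closed_def)
  then have "\<forall>i. \<exists>f. i < k \<longrightarrow> f \<in> poly_funs I \<and> (\<forall>x\<in>Z i. f x = 0) \<and> (\<exists>x\<in>Z (Suc i). f x \<noteq> 0)"
    by blast
  then obtain f where f: "\<forall>i. i < k \<longrightarrow> f i \<in> poly_funs I \<and> (\<forall>x\<in>Z i. f i x = 0) \<and> (\<exists>x\<in>Z (Suc i). f i x \<noteq> 0)"
    unfolding choice_iff by blast
  then have "f i \<in> palg (coord_funs I)" if "i \<in> {..<k}" for i
    using that by (simp add: poly_funs_eq_palg)
  then obtain D where D: "\<And>i. i \<in> {..<k} \<Longrightarrow> poly_deg (coord_funs I) D (f i)"
    using palg_common_degree[OF finite_lessThan, of k f "coord_funs I"] by metis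
  obtain C where C: "\<And>m. spanned S {p. poly_deg (coord_funs I) m p} (C * Suc m ^ K)"
    using g unfolding growth_le_def by blast
  \<comment> \<open>With this choice the bound for degree \<open>k * (m * D)\<close> is at most
    \<open>m * Suc m ^ K\<close>, just below \<open>Suc m ^ Suc K\<close>.\<close>
  define m where "m = C * Suc (k * D) ^ K"
  have "C * Suc (k * (m * D)) ^ K \<le> C * (Suc (k * D) * Suc m) ^ K"
    by (intro mult_le_mono2 power_mono) (auto simp: algebra_simps)
  also have "\<dots> = m * Suc m ^ K" by (simp only: m_def power_mult_distrib mult.assoc)
  also have "\<dots> < Suc m * Suc m ^ K" by simp
  also have "\<dots> = Suc m ^ Suc K" by simp
  also have "\<dots> \<le> Suc m ^ k" using \<open>\<not> k \<le> K\<close> by (intro power_increasing) auto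
  finally have "C * Suc (k * (m * D)) ^ K < card (exponents m k)" by (simp only: card_exponents)
  moreover have deg: "poly_deg (coord_funs I) (k * (m * D)) (monomial f as)" if "as \<in> exponents m k" for as
    using poly_deg_monomial[of as "coord_funs I" D f m] D that by (auto simp: exponents_def)
  ultimately obtain c where c: "\<exists>as\<in>exponents m k. c as \<noteq> 0"
    "\<forall>x\<in>S. (\<Sum>as\<in>exponents m k. c as * monomial f as x) = 0"
    using spanned_dependent[OF C[of "k * (m * D)"] finite_exponents[of m k], of "monomial f"] by auto
  have comb: "(\<lambda>x. \<Sum>as\<in>exponents m k. c as * monomial f as x) \<in> poly_funs I"
    unfolding poly_funs_eq_palg
    by (intro palg_sum palg_mult palg_const) (use deg in \<open>auto simp: palg_def\<close>)
  have rel: "(\<Sum>as\<in>exponents m k. c as * monomial f as x) = 0" if "x \<in> Z k" for x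
  proof -
    have "x \<in> zariski_closure I S" using sub that by blast
    then have "\<forall>p\<in>poly_funs I. (\<forall>y\<in>S. p y = 0) \<longrightarrow> p x = 0"
      unfolding mem_zariski_closure[OF S] by simp
    from this[rule_format, OF comb] c(2) show ?thesis by simp
  qed
  have "c as = 0" if "as \<in> exponents m k" for as
    by (rule chain_monomials_independent[OF irr _ _ _ _ rel that])
       (use f chain in auto)
  then show False using c(1) by blast
qed

section \<open>Concurrent lines\<close>

lemma poly_fun_along_curve:
  assumes "f \<in> poly_funs I" "\<And>i. i \<in> I \<Longrightarrow> \<exists>P. \<forall>t. g t i = poly P t"
  shows "\<exists>P. \<forall>t. f (g t) = poly P t"
  using assms(1)
proof induction
  case (const c)
  show ?case by (rule exI[of _ "[:c:]"]) simp
next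
  case (coord i)
  then show ?case by (rule assms(2))
next
  case (add p q)
  then show ?case by (metis poly_add)
next
  case (mult p q)
  then show ?case by (metis poly_mult)
qed

text \<open>Take \<open>p\<close> vanishing on \<open>A\<close> but not at \<open>u\<close>, and
  \<open>q\<close> vanishing on \<open>B\<close> but not at \<open>v\<close>. Along a curve in
  \<open>S\<close> from \<open>u\<close> to \<open>v\<close> they become nonzero univariate
  polynomials with product zero.\<close>

lemma irreducible_closed_closure:
  assumes S: "S \<subseteq> affine_space I" "S \<noteq> {}"
    and curve: "\<And>u v. u \<in> S \<Longrightarrow> v \<in> S \<Longrightarrow>
      \<exists>g. (\<forall>i\<in>I. \<exists>P. \<forall>t. g t i = poly P t) \<and> (\<forall>t. g t \<in> S) \<and> g 0 = u \<and> g 1 = v"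
  shows "irreducible_closed I (zariski_closure I S)"
  unfolding irreducible_closed_def
proof (intro conjI allI impI)
  let ?Z = "zariski_closure I S"
  show "zariski_closed I ?Z" using S(1) by (rule zariski_closed_zariski_closure)
  show "?Z \<noteq> {}" using S(2) subset_zariski_closure by blast
  fix A B assume AB: "zariski_closed I A \<and> zariski_closed I B \<and> ?Z = A \<union> B"
  show "?Z = A \<or> ?Z = B"
  proof (rule ccontr)
    assume "\<not> ?thesis"
    then have "\<not> S \<subseteq> A" "\<not> S \<subseteq> B" using AB zariski_closure_subset by blast+
    then obtain u v where u: "u \<in> S" "u \<notin> A" and v: "v \<in> S" "v \<notin> B" by blast
    obtain P where P: "P \<subseteq> poly_funs I" "A = {x \<in> affine_space I. \<forall>p\<in>P. p x = 0}"
      using AB unfolding zariski_closed_def by blast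
    obtain Q where Q: "Q \<subseteq> poly_funs I" "B = {x \<in> affine_space I. \<forall>p\<in>Q. p x = 0}"
      using AB unfolding zariski_closed_def by blast
    obtain p where p: "p \<in> poly_funs I" "p u \<noteq> 0" "\<forall>x\<in>A. p x = 0" using P u S(1) by blast
    obtain q where q: "q \<in> poly_funs I" "q v \<noteq> 0" "\<forall>x\<in>B. q x = 0" using Q v S(1) by blast
    obtain g where g: "\<And>i. i \<in> I \<Longrightarrow> \<exists>P. \<forall>t. g t i = poly P t" "\<And>t. g t \<in> S" "g 0 = u" "g 1 = v"
      using curve[OF u(1) v(1)] by blast
    obtain p' where p': "\<forall>t. p (g t) = poly p' t" using poly_fun_along_curve[where g = g, OF p(1) g(1)] by blast
    obtain q' where q': "\<forall>t. q (g t) = poly q' t" using poly_fun_along_curve[where g = g, OF q(1) g(1)] by blast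
    have "poly (p' * q') t = 0" for t
    proof -
      have "g t \<in> A \<union> B" using AB g(2) subset_zariski_closure by blast
      then have "p (g t) = 0 \<or> q (g t) = 0" using p(3) q(3) by blast
      then show ?thesis using p' q' by simp
    qed
    then have "p' * q' = 0" using poly_all_0_iff_0 by blast
    then have "p' = 0 \<or> q' = 0" by simp
    then have "p (g 0) = 0 \<or> q (g 1) = 0" using p' q' by (metis poly_0)
    then show False using p(2) q(2) g(3,4) by simp
  qed
qed

text \<open>The parameters are \<open>w\<^sub>0, w\<^sub>1, w\<^sub>2\<^sub>n\<^sub>+\<^sub>2\<close> for the common point and \<open>w\<^sub>2\<^sub>i, w\<^sub>2\<^sub>i\<^sub>+\<^sub>1\<close> for the direction of the
  \<open>i\<close>-th line. The third coordinate of the point comes last, so that in the flag below it is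
  released when the directions are already free: before that, each new parameter is a coordinate.\<close>

definition concurrent :: "nat \<Rightarrow> (nat \<Rightarrow> complex) \<Rightarrow> nat \<times> nat \<Rightarrow> complex" where
  "concurrent n w = restrict (\<lambda>(i, l).
     if l = 1 then w 0 - w (2 * n + 2) * w (2 * i)
     else if l = 2 then w 1 - w (2 * n + 2) * w (2 * i + 1)
     else w (2 * i + (l - 3))) (coords n)"

lemma concurrent_simps:
  assumes "i \<in> {1..n}"
  shows "concurrent n w (i, 1) = w 0 - w (2 * n + 2) * w (2 * i)"
    "concurrent n w (i, 2) = w 1 - w (2 * n + 2) * w (2 * i + 1)"
    "concurrent n w (i, 3) = w (2 * i)"
    "concurrent n w (i, 4) = w (2 * i + 1)"
  using assms by (simp_all add: concurrent_def coords_def)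

lemma concurrent_affine: "concurrent n w \<in> affine_space (coords n)"
  by (auto simp: concurrent_def affine_space_def)

text \<open>The coordinates are at most quadratic in the parameters, so a segment of parameters
  gives a polynomial curve of configurations.\<close>

lemma concurrent_segment:
  "p \<in> coords n \<Longrightarrow> \<exists>P. \<forall>t. concurrent n (\<lambda>j. u j + t * (v j - u j)) p = poly P t"
proof -
  assume "p \<in> coords n"
  then obtain i l where p: "p = (i, l)" "i \<in> {1..n}" "l \<in> {1..4}" by (auto simp: coords_def)
  define L where "L j = [:u j, v j - u j:]" for j
  have L: "u j + t * (v j - u j) = poly (L j) t" for j t by (simp add: L_def)
  have "l \<in> {1, 2, 3, 4}" using p(3) by auto
  moreover have "\<exists>P. \<forall>t. poly (L a) t - poly (L b) t * poly (L c) t = poly P t" for a b c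
    by (rule exI[of _ "L a - L b * L c"]) simp
  ultimately show ?thesis
    unfolding L p(1) using concurrent_simps[OF p(2)] by auto
qed

section \<open>Concurrent lines as realizations\<close>

text \<open>All the lines pass through the point \<open>(w 0, w 1, w (2 * n + 2))\<close>.\<close>

lemma det_form_concurrent:
  "i \<in> {1..n} \<Longrightarrow> j \<in> {1..n} \<Longrightarrow> det_form (concurrent n w) i j = 0"
  unfolding det_form_def concurrent_simps by algebra

lemma incident_lines_of: "incident (lines_of x i) (lines_of x j) \<longleftrightarrow> det_form x i j = 0"
  by (simp add: lines_of_def incident_line_iff det_form_def)

lemma lines_of_neq: "lines_of x i \<noteq> lines_of x j \<longleftrightarrow> separated x i j"
  by (auto simp: lines_of_def line_eq_iff separated_def)

lemma X_hat_subset_realizations: "X_hat n E \<subseteq> realizations {1..n} E"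
proof
  fix x assume x: "x \<in> X_hat n E"
  have "separated x i j" if "i \<in> {1..n}" "j \<in> {1..n}" "i \<noteq> j" for i j
  proof -
    have "inj_on (lines_of x) {1..n}" using x by (simp add: X_hat_def)
    from inj_onD[OF this _ that(1,2)] that(3) show ?thesis unfolding lines_of_neq[symmetric] by blast
  qed
  moreover have "det_form x i j = 0" if "{i, j} \<in> E" for i j
  proof -
    have "{i, j} \<in> intersection_edges n (lines_of x)" using x that by (auto simp: X_hat_def)
    then obtain i' j' where "{i, j} = {i', j'}" "det_form x i' j' = 0"
      by (auto simp: intersection_edges_def incident_lines_of)
    then show ?thesis using det_form_commute[of x i j] by (auto simp: doubleton_eq_iff)
  qed
  ultimately show "x \<in> realizations {1..n} E" by (simp add: realizations_def)
qed

lemma concurrent_in_X_hat: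
  assumes "E \<subseteq> [{1..n}]\<^bsup>2\<^esup>" "inj_on (\<lambda>i. w (2 * i)) {1..n}"
  shows "concurrent n w \<in> X_hat n E"
proof -
  have "E \<subseteq> intersection_edges n (lines_of (concurrent n w))"
  proof
    fix e assume "e \<in> E"
    then have e: "e \<subseteq> {1..n}" "card e = 2" using assms(1) by (auto simp: nsets_def)
    then obtain i j where ij: "e = {i, j}" "i \<noteq> j" by (auto simp: card_2_iff)
    then have "i \<in> {1..n}" "j \<in> {1..n}" using e(1) by auto
    moreover from this have "det_form (concurrent n w) i j = 0" by (rule det_form_concurrent)
    ultimately show "e \<in> intersection_edges n (lines_of (concurrent n w))"
      unfolding intersection_edges_def incident_lines_of using ij by blast
  qed
  moreover have "inj_on (lines_of (concurrent n w)) {1..n}"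
  proof (rule inj_onI, rule ccontr)
    fix i j assume ij: "i \<in> {1..n}" "j \<in> {1..n}" "i \<noteq> j"
    have "w (2 * i) \<noteq> w (2 * j)" using inj_onD[OF assms(2) _ ij(1,2)] ij(3) by blast
    then have "separated (concurrent n w) i j"
      unfolding separated_def concurrent_simps[OF ij(1)] concurrent_simps[OF ij(2)] by simp
    moreover assume "lines_of (concurrent n w) i = lines_of (concurrent n w) j"
    ultimately show False unfolding lines_of_neq[symmetric] by simp
  qed
  ultimately show ?thesis by (simp add: X_hat_def concurrent_affine)
qed

lemma X_hat_affine: "X_hat n E \<subseteq> affine_space (coords n)"
  by (auto simp: X_hat_def)

text \<open>A segment joins \<open>w\<close> to parameters with distinct directions. All but
  finitely many of its points give distinct lines, and a polynomial vanishing at those vanishes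
  along the whole segment.\<close>

lemma concurrent_in_X_var:
  assumes "E \<subseteq> [{1..n}]\<^bsup>2\<^esup>"
  shows "concurrent n w \<in> X_var n E"
  unfolding X_var_def mem_zariski_closure[OF X_hat_affine]
proof (intro conjI ballI impI concurrent_affine)
  fix p assume p: "p \<in> poly_funs (coords n)" and zero: "\<forall>y\<in>X_hat n E. p y = 0"
  \<comment> \<open>The segment starts at \<open>w\<close> for \<open>t = 0\<close> and ends for
    \<open>t = 1\<close> at the parameters 0, 1, 2, ..., which are pairwise distinct.\<close>
  define L where "L t j = w j + t * (of_nat j - w j)" for t j
  obtain P where P: "\<forall>t. p (concurrent n (L t)) = poly P t"
    using poly_fun_along_curve[where g = "\<lambda>t. concurrent n (L t)", OF p]
      concurrent_segment[of _ n w of_nat] unfolding L_def by blast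
  define bad where "bad = (\<Union>(i, j)\<in>{(i, j) \<in> {1..n} \<times> {1..n}. i \<noteq> j}. {t. L t (2 * i) = L t (2 * j)})"
  have fin: "finite {t. L t (2 * i) = L t (2 * j)}" if "i \<noteq> j" for i j
  proof -
    \<comment> \<open>The difference of the two parameters as a polynomial in \<open>t\<close>,
      nonzero because its value at 1 is.\<close>
    let ?Q = "[:w (2 * i) - w (2 * j), of_nat (2 * i) - w (2 * i) - (of_nat (2 * j) - w (2 * j)):]"
    have "poly ?Q 1 = of_nat (2 * i) - of_nat (2 * j)" by simp
    also have "\<dots> \<noteq> 0" using that by simp
    finally have "?Q \<noteq> 0" by (metis poly_0)
    then have "finite {t. poly ?Q t = 0}" by (rule poly_roots_finite)
    moreover have "{t. L t (2 * i) = L t (2 * j)} = {t. poly ?Q t = 0}"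
      by (auto simp: L_def algebra_simps)
    ultimately show ?thesis by simp
  qed
  have "finite {(i, j) \<in> {1..n} \<times> {1..n}. i \<noteq> j}"
    by (rule finite_subset[of _ "{1..n} \<times> {1..n}"]) auto
  then have "finite bad" unfolding bad_def by (rule finite_UN_I) (use fin in auto)
  moreover have "poly P t = 0" if "t \<notin> bad" for t
  proof -
    have "inj_on (\<lambda>i. L t (2 * i)) {1..n}"
    proof (rule inj_onI, rule ccontr)
      fix i j assume "i \<in> {1..n}" "j \<in> {1..n}" "L t (2 * i) = L t (2 * j)" "i \<noteq> j"
      then have "t \<in> bad" unfolding bad_def by blast
      then show False using that by contradiction
    qed
    from concurrent_in_X_hat[OF assms this] show ?thesis using zero P by metis
  qed
  then have "- bad \<subseteq> {t. poly P t = 0}" by auto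
  ultimately have "infinite {t. poly P t = 0}"
    using infinite_UNIV_char_0[where 'a = complex] by (metis Compl_eq_Diff_UNIV Diff_infinite_finite finite_subset)
  then have "P = 0" using poly_roots_finite by blast
  moreover have "L 0 = w" by (auto simp: L_def)
  ultimately show "p (concurrent n w) = 0" using P by (metis poly_0)
qed

section \<open>The flag of concurrent configurations\<close>

text \<open>Parameters from index \<open>j\<close> on are zero: \<open>flag n 0\<close> is the
  closure of a single point, and for \<open>j = 2 * n + 3\<close> all parameters that
  \<open>concurrent n\<close> reads are free.\<close>

definition flag :: "nat \<Rightarrow> nat \<Rightarrow> (nat \<times> nat \<Rightarrow> complex) set" where
  "flag n j = zariski_closure (coords n) (concurrent n ` {w. \<forall>i\<ge>j. w i = 0})"

text \<open>The admissible parameters form a linear space, so segments between them supply the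
  curves for \<open>irreducible_closed_closure\<close>.\<close>

lemma flag_irreducible: "irreducible_closed (coords n) (flag n j)"
  unfolding flag_def
proof (rule irreducible_closed_closure)
  show "concurrent n ` {w. \<forall>i\<ge>j. w i = 0} \<subseteq> affine_space (coords n)"
    by (auto simp: concurrent_affine)
  show "concurrent n ` {w. \<forall>i\<ge>j. w i = 0} \<noteq> {}" by (auto intro: exI[of _ "\<lambda>_. 0"])
  fix x y assume "x \<in> concurrent n ` {w. \<forall>i\<ge>j. w i = 0}" "y \<in> concurrent n ` {w. \<forall>i\<ge>j. w i = 0}"
  then obtain u v where uv: "x = concurrent n u" "\<forall>i\<ge>j. u i = 0" "y = concurrent n v" "\<forall>i\<ge>j. v i = 0"
    by auto
  show "\<exists>g. (\<forall>i\<in>coords n. \<exists>P. \<forall>t. g t i = poly P t) \<and>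
      (\<forall>t. g t \<in> concurrent n ` {w. \<forall>i\<ge>j. w i = 0}) \<and> g 0 = x \<and> g 1 = y"
    by (rule exI[of _ "\<lambda>t. concurrent n (\<lambda>j. u j + t * (v j - u j))"])
       (use uv concurrent_segment in auto)
qed

text \<open>As long as \<open>w (2 * n + 2)\<close> is zero, each \<open>w j\<close> is itself a
  coordinate of the configuration and separates. Only the last step calls for a different
  polynomial.\<close>

lemma flag_separating:
  assumes "2 \<le> n" "j \<le> 2 * n + 2"
  shows "\<exists>s\<in>poly_funs (coords n). (\<forall>w. (\<forall>i\<ge>j. w i = 0) \<longrightarrow> s (concurrent n w) = 0) \<and>
    (\<exists>w. (\<forall>i\<ge>Suc j. w i = 0) \<and> s (concurrent n w) \<noteq> 0)"
proof -
  have co: "(\<lambda>x. x (i, l)) \<in> poly_funs (coords n)" if "i \<in> {1..n}" "l \<in> {1..4}" for i l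
    by (rule poly_funs.coord) (use that in \<open>auto simp: coords_def\<close>)
  have 1: "1 \<in> {1..n}" and 2: "2 \<in> {1..n}" using assms(1) by auto
  consider "j = 0" | "j = 1" | i where "i \<in> {1..n}" "j = 2 * i" | i where "i \<in> {1..n}" "j = 2 * i + 1"
    | "j = 2 * n + 2"
  proof -
    have "j = 2 * (j div 2) \<or> j = 2 * (j div 2) + 1" by presburger
    then show ?thesis using that assms(2) by (cases "j < 2"; cases "j = 2 * n + 2") force+
  qed
  then show ?thesis
  proof cases
    case 1
    then show ?thesis using concurrent_simps(1)[OF \<open>1 \<in> {1..n}\<close>]
      by (intro bexI[OF _ co[of 1 1]] conjI exI[of _ "\<lambda>i. if i = 0 then 1 else 0"]) (use assms in auto)
  next
    case 2
    then show ?thesis using concurrent_simps(2)[OF \<open>1 \<in> {1..n}\<close>]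
      by (intro bexI[OF _ co[of 1 2]] conjI exI[of _ "\<lambda>i. if i = 1 then 1 else 0"]) (use assms in auto)
  next
    case (3 i)
    then show ?thesis using concurrent_simps(3)[OF 3(1)]
      by (intro bexI[OF _ co[of i 3]] conjI exI[of _ "\<lambda>i. if i = j then 1 else 0"]) auto
  next
    case (4 i)
    then show ?thesis using concurrent_simps(4)[OF 4(1)]
      by (intro bexI[OF _ co[of i 4]] conjI exI[of _ "\<lambda>i. if i = j then 1 else 0"]) auto
  next
    case 5
    let ?s = "\<lambda>x. x (1, 1) + (\<lambda>_. - 1) x * x (2, 1)"
    \<comment> \<open>The value is \<open>1 * (0 - 1)\<close>: \<open>2 \<le> n\<close> makes
      \<open>2 * n + 2\<close> different from 4.\<close>
    let ?w = "\<lambda>i. if i = 2 \<or> i = 2 * n + 2 then 1 else 0"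
    have "?s \<in> poly_funs (coords n)"
      by (intro poly_funs.add poly_funs.mult poly_funs.const co 1 2) auto
    moreover have "?s (concurrent n w) = w (2 * n + 2) * (w 4 - w 2)" for w
    proof -
      have "w (2 * 1) = w 2" "w (2 * 2) = w 4" by simp_all
      then show ?thesis
        unfolding concurrent_simps(1)[OF 1] concurrent_simps(1)[OF 2] by (simp add: right_diff_distrib)
    qed
    moreover have "?w (2 * n + 2) * (?w 4 - ?w 2) \<noteq> (0::complex)" using assms(1) by simp
    moreover have "\<forall>i\<ge>Suc j. ?w i = (0::complex)" using 5 by auto
    ultimately show ?thesis using 5 by (intro bexI[of _ ?s] conjI exI[of _ ?w]) auto
  qed
qed

lemma flag_strict_mono:
  assumes "2 \<le> n" "j \<le> 2 * n + 2"
  shows "flag n j \<subset> flag n (Suc j)"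
proof (rule psubsetI)
  have aff: "concurrent n ` W \<subseteq> affine_space (coords n)" for W by (auto simp: concurrent_affine)
  show "flag n j \<subseteq> flag n (Suc j)"
    unfolding flag_def
    by (rule zariski_closure_subset[OF zariski_closed_zariski_closure[OF aff]],
        rule order_trans[OF _ subset_zariski_closure]) auto
  obtain s w where s: "s \<in> poly_funs (coords n)" "\<forall>w. (\<forall>i\<ge>j. w i = 0) \<longrightarrow> s (concurrent n w) = 0"
    and w: "\<forall>i\<ge>Suc j. w i = 0" "s (concurrent n w) \<noteq> 0"
    using flag_separating[OF assms] by blast
  have "concurrent n w \<in> flag n (Suc j)"
    unfolding flag_def using w(1) by (intro subsetD[OF subset_zariski_closure]) auto
  moreover have "concurrent n w \<notin> flag n j"
    unfolding flag_def mem_zariski_closure[OF aff] using s w(2) by auto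
  ultimately show "flag n j \<noteq> flag n (Suc j)" by blast
qed

lemma flag_subset_X_var:
  assumes "E \<subseteq> [{1..n}]\<^bsup>2\<^esup>"
  shows "flag n j \<subseteq> X_var n E"
  unfolding flag_def
  by (rule zariski_closure_subset)
     (auto simp: X_var_def[symmetric] concurrent_in_X_var[OF assms]
       intro: zariski_closed_zariski_closure[OF X_hat_affine, folded X_var_def])

section \<open>The dimension of \<open>X_var\<close>\<close>

theorem theorem3p2:
  fixes n :: nat and E :: "nat set set"
  assumes "laman_graph {1..n} E"
  shows "variety_dim (coords n) (X_var n E) = enat (2 * n + 3)"
proof (rule antisym)
  note sp = laman_graph_imp_sparse[OF assms]
  have cardE: "int (card E) = 2 * int n - 3" using assms by (simp add: laman_graph_def)
  \<comment> \<open>For \<open>n < 2\<close> the number of edges would be negative.\<close>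
  then have n: "2 \<le> n" by linarith
  have E: "E \<subseteq> [{1..n}]\<^bsup>2\<^esup>" using assms by (simp add: laman_graph_def simple_graph_def)
  have "4 * card {1..n} - card E = 2 * n + 3" using cardE n by simp
  then have "growth_le (coord_funs (coords n)) (realizations {1..n} E) (2 * n + 3)"
    using growth_le_realizations[OF sp] unfolding coords_def by metis
  then have g: "growth_le (coord_funs (coords n)) (X_hat n E) (2 * n + 3)"
    by (rule growth_le_mono[OF _ order_refl X_hat_subset_realizations order_refl])
  show "variety_dim (coords n) (X_var n E) \<le> enat (2 * n + 3)"
    unfolding variety_dim_def
  proof (rule Sup_least, clarify)
    fix k Z
    assume Z: "\<forall>i\<le>k. irreducible_closed (coords n) (Z i) \<and> Z i \<subseteq> X_var n E" "\<forall>i<k. Z i \<subset> Z (Suc i)"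
    have "k \<le> 2 * n + 3"
      by (rule growth_le_chain_length[OF g X_hat_affine, of _ Z]) (use Z in \<open>auto simp: X_var_def\<close>)
    then show "enat k \<le> enat (2 * n + 3)" by simp
  qed
  show "enat (2 * n + 3) \<le> variety_dim (coords n) (X_var n E)"
    unfolding variety_dim_def
  proof (rule Sup_upper, rule CollectI, intro exI conjI)
    show "\<forall>i\<le>2 * n + 3. irreducible_closed (coords n) (flag n i) \<and> flag n i \<subseteq> X_var n E"
      using flag_irreducible flag_subset_X_var[OF E] by blast
    show "\<forall>i<2 * n + 3. flag n i \<subset> flag n (Suc i)" using flag_strict_mono[OF n] by simp
  qed simp
qed

end
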